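(* Let $G$ be a virtually cyclic group with finite generating set $X$. Then for all rational subsets $U$ of $G$, the language $\mathrm{ConjSL}_X(U)$ is regular.
   Context: Let $G$ be a finitely generated group with finite generating set $X\subseteq G$, let $\widetilde X=X\cup X^{-1}$ and let $\pi:\widetilde X^*\to G$ be the canonical surjective monoid homomorphism. Fix a total order on $\widetilde X$ and the induced shortlex order on $\widetilde X^*$. For a conjugacy class $c$ of $G$, $z_c$ denotes the shortlex-least word over $\widetilde X$ representing an element of $c$. For $U\subseteq G$ put $\alpha(U)=\bigcup_{g\in G}g^{-1}Ug$ and $$\mathrm{ConjSL}_X(U)=\{z_c : c \text{ a conjugacy class of } G,\ z_c\pi\in\alpha(U)\},$$ i.e. the set of $z_c$ for the conjugacy classes $c$ meeting $U$. A subset $U\subseteq G$ is rational if there is a regular language $L\subseteq\widetilde X^*$ with $L\pi=U$. *)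

theory Defs
  imports "HOL-Algebra.Elementary_Groups"
begin

text \<open>Recognition by a complete deterministic finite automaton over the finite alphabet \<open>A\<close>.
  Taking the states to be natural numbers is no restriction, as the state set is finite.\<close>

definition regular_language :: "'a set \<Rightarrow> 'a list set \<Rightarrow> bool" where
  "regular_language A L \<longleftrightarrow> finite A \<and>
     (\<exists>(Q :: nat set) q0 \<delta> F. finite Q \<and> q0 \<in> Q \<and> F \<subseteq> Q \<and>
        (\<forall>q\<in>Q. \<forall>a\<in>A. \<delta> q a \<in> Q) \<and>
        L = {w \<in> lists A. foldl \<delta> q0 w \<in> F})"

definition virtually_cyclic :: "('a, 'b) monoid_scheme \<Rightarrow> bool" where
  "virtually_cyclic G \<longleftrightarrow> group G \<and>
     (\<exists>H. subgroup H G \<and> cyclic_group (G\<lparr>carrier := H\<rparr>) \<and> finite (rcosets\<^bsub>G\<^esub> H))"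

text \<open>Letters are elements of the group, so that \<open>X\<close> and its set of inverses may overlap.\<close>

definition sym_gens :: "('a, 'b) monoid_scheme \<Rightarrow> 'a set \<Rightarrow> 'a set" where
  "sym_gens G X = X \<union> m_inv G ` X"

definition word_eval :: "('a, 'b) monoid_scheme \<Rightarrow> 'a list \<Rightarrow> 'a" where
  "word_eval G w = foldr (\<otimes>\<^bsub>G\<^esub>) w \<one>\<^bsub>G\<^esub>"

definition rational_subset :: "('a, 'b) monoid_scheme \<Rightarrow> 'a set \<Rightarrow> 'a set \<Rightarrow> bool" where
  "rational_subset G X U \<longleftrightarrow>
     (\<exists>L. regular_language (sym_gens G X) L \<and> word_eval G ` L = U)"

definition conj_closure :: "('a, 'b) monoid_scheme \<Rightarrow> 'a set \<Rightarrow> 'a set" where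
  "conj_closure G U = (\<Union>g\<in>carrier G. {inv\<^bsub>G\<^esub> g \<otimes>\<^bsub>G\<^esub> u \<otimes>\<^bsub>G\<^esub> g | u. u \<in> U})"

definition conj_classes :: "('a, 'b) monoid_scheme \<Rightarrow> 'a set set" where
  "conj_classes G = {{inv\<^bsub>G\<^esub> g \<otimes>\<^bsub>G\<^esub> x \<otimes>\<^bsub>G\<^esub> g | g. g \<in> carrier G} | x. x \<in> carrier G}"

text \<open>The reflexive pairs of \<open>r\<close> are removed because \<^const>\<open>lenlex\<close> expects a strict order;
  the result is the strict shortlex order.\<close>

definition shortlex :: "('a \<times> 'a) set \<Rightarrow> ('a list \<times> 'a list) set" where
  "shortlex r = lenlex (r - Id)"

definition conj_rep ::
  "('a, 'b) monoid_scheme \<Rightarrow> 'a set \<Rightarrow> ('a \<times> 'a) set \<Rightarrow> 'a set \<Rightarrow> 'a list" where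
  "conj_rep G X r c =
     (THE w. w \<in> lists (sym_gens G X) \<and> word_eval G w \<in> c \<and>
        (\<forall>v \<in> lists (sym_gens G X). word_eval G v \<in> c \<longrightarrow> v = w \<or> (w, v) \<in> shortlex r))"

text \<open>The definite description in \<^const>\<open>conj_rep\<close> denotes.\<close>

lemma wf_shortlex:
  assumes "linear_order_on A r" and "finite A"
  shows "wf (shortlex r)"
proof -
  have "r \<subseteq> A \<times> A"
    using assms(1) by (simp add: order_on_defs)
  then have "finite (r - Id)"
    using assms(2) by (meson finite_Diff finite_SigmaI finite_subset)
  then have "wf (r - Id)"
    using finite_acyclic_wf[OF _ linear_order_on_acyclic[OF assms(1)]] by blast
  then show ?thesis
    unfolding shortlex_def by (rule wf_lenlex)
qed

lemma total_shortlex: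
  assumes "linear_order_on A r" and "xs \<in> lists A" "ys \<in> lists A" "xs \<noteq> ys"
  shows "(xs, ys) \<in> shortlex r \<or> (ys, xs) \<in> shortlex r"
proof (cases "length xs = length ys")
  case True
  then obtain pre x xs' y ys' where "x \<noteq> y" and xs: "xs = pre @ [x] @ xs'" and ys: "ys = pre @ [y] @ ys'"
    using assms(4) same_length_different by blast
  moreover have "total_on A r"
    using assms(1) by (simp add: order_on_defs)
  ultimately have "(x, y) \<in> r - Id \<or> (y, x) \<in> r - Id"
    using assms(2,3) by (auto simp: total_on_def)
  then have "(xs, ys) \<in> lex (r - Id) \<or> (ys, xs) \<in> lex (r - Id)"
    using True unfolding lex_conv mem_Collect_eq case_prod_conv xs ys by (metis append_Cons append_Nil)
  then show ?thesis
    using True by (auto simp: shortlex_def lenlex_conv)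
next
  case False
  then show ?thesis
    by (auto simp: shortlex_def lenlex_conv)
qed

lemma (in group) word_eval_append:
  assumes "set u \<subseteq> carrier G" "set v \<subseteq> carrier G"
  shows "word_eval G u \<in> carrier G" "word_eval G (u @ v) = word_eval G u \<otimes> word_eval G v"
proof -
  have closed: "word_eval G w \<in> carrier G" if "set w \<subseteq> carrier G" for w
    using that by (induction w) (auto simp: word_eval_def)
  then show "word_eval G u \<in> carrier G"
    using assms by blast
  show "word_eval G (u @ v) = word_eval G u \<otimes> word_eval G v"
    using assms
  proof (induction u)
    case Nil
    then show ?case using closed[of v] by (simp add: word_eval_def)
  next
    case (Cons a u)
    then show ?case using closed[of u] closed[of v] by (simp add: word_eval_def m_assoc)
  qed
qed

lemma (in group) word_eval_surj:
  assumes "X \<subseteq> carrier G" and "x \<in> generate G X"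
  shows "\<exists>w \<in> lists (sym_gens G X). word_eval G w = x"
proof -
  have sub: "sym_gens G X \<subseteq> carrier G"
    using assms(1) by (auto simp: sym_gens_def)
  show ?thesis
    using assms(2)
  proof (induction rule: generate.induct)
    case one
    show ?case by (rule bexI[of _ "[]"]) (auto simp: word_eval_def)
  next
    case (incl h)
    then show ?case using assms(1)
      by (intro bexI[of _ "[h]"]) (auto simp: word_eval_def sym_gens_def)
  next
    case (inv h)
    then show ?case using assms(1)
      by (intro bexI[of _ "[inv h]"]) (auto simp: word_eval_def sym_gens_def)
  next
    case (eng h1 h2)
    then obtain u v where uv: "u \<in> lists (sym_gens G X)" "v \<in> lists (sym_gens G X)"
      "word_eval G u = h1" "word_eval G v = h2" by blast
    then have "set u \<subseteq> carrier G" "set v \<subseteq> carrier G"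
      using sub by auto
    then show ?case
      using uv by (intro bexI[of _ "u @ v"]) (simp_all add: word_eval_append)
  qed
qed

lemma (in group) conj_rep_exists_unique:
  assumes "finite X" "X \<subseteq> carrier G" "generate G X = carrier G"
    and "linear_order_on (sym_gens G X) r" and "c \<in> conj_classes G"
  shows "\<exists>!w. w \<in> lists (sym_gens G X) \<and> word_eval G w \<in> c \<and>
        (\<forall>v \<in> lists (sym_gens G X). word_eval G v \<in> c \<longrightarrow> v = w \<or> (w, v) \<in> shortlex r)"
proof -
  let ?A = "sym_gens G X"
  let ?W = "{w \<in> lists ?A. word_eval G w \<in> c}"
  have wf: "wf (shortlex r)"
    using assms(1,4) by (intro wf_shortlex[of ?A]) (auto simp: sym_gens_def)
  obtain x where x: "x \<in> carrier G" "c = {inv g \<otimes> x \<otimes> g | g. g \<in> carrier G}"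
    using assms(5) by (auto simp: conj_classes_def)
  then have "inv \<one> \<otimes> x \<otimes> \<one> \<in> c"
    by blast
  then have "x \<in> c"
    using x by simp
  then obtain w0 where w0: "w0 \<in> ?W"
    using word_eval_surj[of X x] assms(2,3) x(1) by auto
  obtain w where w: "w \<in> ?W" and min: "\<And>v. (v, w) \<in> shortlex r \<Longrightarrow> v \<notin> ?W"
    by (rule wfE_min[OF wf w0]) (rule that)
  have least: "v = w \<or> (w, v) \<in> shortlex r" if "v \<in> ?W" for v
    using that w min[of v] total_shortlex[OF assms(4), of v w] by blast
  show ?thesis
  proof (intro ex1I[of _ w] conjI ballI impI)
    fix u
    assume u: "u \<in> lists ?A \<and> word_eval G u \<in> c \<and>
      (\<forall>v \<in> lists ?A. word_eval G v \<in> c \<longrightarrow> v = u \<or> (u, v) \<in> shortlex r)"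
    then have "w = u \<or> (u, w) \<in> shortlex r"
      using w by blast
    then show "u = w"
      using min[of u] u by blast
  qed (use w least in auto)
qed

definition ConjSL ::
  "('a, 'b) monoid_scheme \<Rightarrow> 'a set \<Rightarrow> ('a \<times> 'a) set \<Rightarrow> 'a set \<Rightarrow> 'a list set" where
  "ConjSL G X r U =
     {conj_rep G X r c | c. c \<in> conj_classes G \<and> word_eval G (conj_rep G X r c) \<in> conj_closure G U}"

end

theory Submission
  imports Defs
begin

text \<open>If \<open>G\<close> is infinite, it has an element \<open>t\<close> of infinite order that every element centralises or
  inverts, and \<open>G = \<langle>t\<rangle> R\<close> with \<open>R\<close> finite. Elements inverting \<open>t\<close> form finitely many conjugacy
  classes, and the class of an element centralising \<open>t\<close> consists of its conjugates by \<open>R\<close>. Since \<open>G\<close>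
  has two ends, a nearly geodesic word runs within bounded distance of the shortlex-least word for
  the same element, and likewise for a conjugate by an element of \<open>R\<close>. So a finite automaton can
  detect that a word is not least in its class.

  Pumping shows that a rational subset is eventually periodic along \<open>t\<close>; hence so is the set of
  conjugates of its elements that centralise \<open>t\<close>. For a long geodesic \<open>w\<close> the sign of the exponent of
  \<open>t\<close> is already determined by a prefix of bounded length, so membership of \<open>w\<close> in such a set depends
  only on that prefix, on the exponent modulo the period and on the coset.\<close>

section \<open>Regular languages and right congruences\<close>

text \<open>Automata appear as maps on words that have finite range and whose value on
  \<open>u @ [a]\<close> depends only on \<open>a\<close> and on the value at \<open>u\<close>. Two
  obstacles shape the argument. A smaller word is sure to stay nearby only if the given word is
  nearly geodesic, whereas an automaton meets every word; so least words of single elements are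
  treated before those of classes. They are closed under prefixes, and a word whose proper prefixes
  are all least exceeds a geodesic in length by at most 2. The class test then runs on words already
  known to be geodesic. Secondly, exponents of \<open>t\<close> are unbounded and only their
  residues can be stored, which decides membership beyond some threshold but not below it; short
  words are therefore stored whole. The element \<open>t\<close> is a generator of the cyclic
  subgroup raised to the factorial of the index: all conjugates of this power lie in the cyclic
  subgroup, and comparing exponents there shows that conjugation fixes or inverts it.\<close>

lemma regular_languageI:
  fixes \<phi> :: "'a list \<Rightarrow> 's"
  assumes A: "finite A" and L: "L \<subseteq> lists A" and fin: "finite (\<phi> ` lists A)"
    and step: "\<And>u v a. \<lbrakk>u \<in> lists A; v \<in> lists A; a \<in> A; \<phi> u = \<phi> v\<rbrakk> \<Longrightarrow> \<phi> (u @ [a]) = \<phi> (v @ [a])"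
    and sat: "\<And>u v. \<lbrakk>u \<in> lists A; v \<in> lists A; \<phi> u = \<phi> v; u \<in> L\<rbrakk> \<Longrightarrow> v \<in> L"
  shows "regular_language A L"
proof -
  obtain e :: "'s \<Rightarrow> nat" where e: "inj_on e (\<phi> ` lists A)"
    using finite_imp_inj_to_nat_seg[OF fin] by blast
  define \<psi> where "\<psi> w = e (\<phi> w)" for w
  have \<psi>: "\<psi> u = \<psi> v \<longleftrightarrow> \<phi> u = \<phi> v" if "u \<in> lists A" "v \<in> lists A" for u v
    using e that by (auto simp: \<psi>_def inj_on_def)
  define rep where "rep q = (SOME u. u \<in> lists A \<and> \<psi> u = q)" for q
  have rep: "rep (\<psi> u) \<in> lists A" "\<psi> (rep (\<psi> u)) = \<psi> u" if "u \<in> lists A" for u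
    using someI[of "\<lambda>v. v \<in> lists A \<and> \<psi> v = \<psi> u" u] that by (auto simp: rep_def)
  \<comment> \<open>The transition reads the letter after an arbitrary word leading to the state;
    \<open>step\<close> makes the choice of that word irrelevant.\<close>
  define \<delta> where "\<delta> q a = \<psi> (rep q @ [a])" for q a
  have \<delta>: "\<delta> (\<psi> u) a = \<psi> (u @ [a])" if "u \<in> lists A" "a \<in> A" for u a
    unfolding \<delta>_def using that rep[of u] \<psi> step[of "rep (\<psi> u)" u a] by auto
  have run: "foldl \<delta> (\<psi> []) w = \<psi> w" if "w \<in> lists A" for w
    using that by (induction w rule: rev_induct) (auto simp: \<delta>)
  show ?thesis
    unfolding regular_language_def
  proof (rule conjI[OF A], rule exI[of _ "\<psi> ` lists A"], rule exI[of _ "\<psi> []"], rule exI[of _ \<delta>],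
      rule exI[of _ "\<psi> ` L"], intro conjI)
    have "\<psi> ` lists A = e ` \<phi> ` lists A"
      by (auto simp: \<psi>_def)
    then show "finite (\<psi> ` lists A)"
      using fin by simp
    show "\<forall>q\<in>\<psi> ` lists A. \<forall>a\<in>A. \<delta> q a \<in> \<psi> ` lists A"
      using \<delta> by (auto intro!: imageI)
    show "L = {w \<in> lists A. foldl \<delta> (\<psi> []) w \<in> \<psi> ` L}"
    proof (intro equalityI subsetI)
      fix w assume "w \<in> {w \<in> lists A. foldl \<delta> (\<psi> []) w \<in> \<psi> ` L}"
      then obtain u where "w \<in> lists A" "u \<in> L" "\<psi> w = \<psi> u"
        using run by (metis (mono_tags, lifting) imageE mem_Collect_eq)
      then show "w \<in> L"
        using \<psi>[of w u] sat[of u w] L by (metis subsetD)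
    qed (use L in \<open>auto simp: run[OF subsetD[OF L]]\<close>)
  qed (use L in auto)
qed

lemma regular_languageE:
  assumes "regular_language A L"
  obtains \<phi> :: "'a list \<Rightarrow> nat" where "finite A" "L \<subseteq> lists A" "finite (\<phi> ` lists A)"
    "\<And>u v a. \<lbrakk>u \<in> lists A; v \<in> lists A; a \<in> A; \<phi> u = \<phi> v\<rbrakk> \<Longrightarrow> \<phi> (u @ [a]) = \<phi> (v @ [a])"
    "\<And>u v. \<lbrakk>u \<in> lists A; v \<in> lists A; \<phi> u = \<phi> v\<rbrakk> \<Longrightarrow> u \<in> L \<longleftrightarrow> v \<in> L"
proof -
  obtain Q :: "nat set" and q0 \<delta> F where A: "finite A" "finite Q" "q0 \<in> Q"
    and \<delta>: "\<forall>q\<in>Q. \<forall>a\<in>A. \<delta> q a \<in> Q" and L: "L = {w \<in> lists A. foldl \<delta> q0 w \<in> F}"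
    using assms unfolding regular_language_def by blast
  have "foldl \<delta> q0 w \<in> Q" if "w \<in> lists A" for w
    using that by (induction w rule: rev_induct) (use A \<delta> in auto)
  then have "finite (foldl \<delta> q0 ` lists A)"
    using finite_subset[OF _ \<open>finite Q\<close>] by blast
  then show ?thesis
    by (intro that[of "foldl \<delta> q0"]) (use A L in auto)
qed

lemma regular_language_inter:
  assumes "regular_language A L" "regular_language A L'"
  shows "regular_language A (L \<inter> L')"
proof -
  obtain \<phi> :: "'a list \<Rightarrow> nat" where \<phi>: "finite A" "L \<subseteq> lists A" "finite (\<phi> ` lists A)"
    "\<And>u v a. \<lbrakk>u \<in> lists A; v \<in> lists A; a \<in> A; \<phi> u = \<phi> v\<rbrakk> \<Longrightarrow> \<phi> (u @ [a]) = \<phi> (v @ [a])"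
    "\<And>u v. \<lbrakk>u \<in> lists A; v \<in> lists A; \<phi> u = \<phi> v\<rbrakk> \<Longrightarrow> u \<in> L \<longleftrightarrow> v \<in> L"
    using regular_languageE[OF assms(1)] by metis
  obtain \<psi> :: "'a list \<Rightarrow> nat" where \<psi>: "finite (\<psi> ` lists A)"
    "\<And>u v a. \<lbrakk>u \<in> lists A; v \<in> lists A; a \<in> A; \<psi> u = \<psi> v\<rbrakk> \<Longrightarrow> \<psi> (u @ [a]) = \<psi> (v @ [a])"
    "\<And>u v. \<lbrakk>u \<in> lists A; v \<in> lists A; \<psi> u = \<psi> v\<rbrakk> \<Longrightarrow> u \<in> L' \<longleftrightarrow> v \<in> L'"
    using regular_languageE[OF assms(2)] by metis
  show ?thesis
  proof (rule regular_languageI[of A _ "\<lambda>w. (\<phi> w, \<psi> w)"])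
    show "finite ((\<lambda>w. (\<phi> w, \<psi> w)) ` lists A)"
      by (rule finite_subset[of _ "\<phi> ` lists A \<times> \<psi> ` lists A"]) (use \<phi>(3) \<psi>(1) in auto)
    show "(\<phi> (u @ [a]), \<psi> (u @ [a])) = (\<phi> (v @ [a]), \<psi> (v @ [a]))"
      if "u \<in> lists A" "v \<in> lists A" "a \<in> A" "(\<phi> u, \<psi> u) = (\<phi> v, \<psi> v)" for u v a
      using that \<phi>(4)[of u v a] \<psi>(2)[of u v a] by blast
    show "v \<in> L \<inter> L'" if "u \<in> lists A" "v \<in> lists A" "(\<phi> u, \<psi> u) = (\<phi> v, \<psi> v)" "u \<in> L \<inter> L'" for u v
      using that \<phi>(5)[of u v] \<psi>(3)[of u v] by auto
  qed (use \<phi>(1,2) in auto)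
qed

lemma regular_language_compl:
  assumes "regular_language A L"
  shows "regular_language A (lists A - L)"
proof -
  obtain \<phi> :: "'a list \<Rightarrow> nat" where \<phi>: "finite A" "finite (\<phi> ` lists A)"
    "\<And>u v a. \<lbrakk>u \<in> lists A; v \<in> lists A; a \<in> A; \<phi> u = \<phi> v\<rbrakk> \<Longrightarrow> \<phi> (u @ [a]) = \<phi> (v @ [a])"
    "\<And>u v. \<lbrakk>u \<in> lists A; v \<in> lists A; \<phi> u = \<phi> v\<rbrakk> \<Longrightarrow> u \<in> L \<longleftrightarrow> v \<in> L"
    using regular_languageE[OF assms] by metis
  show ?thesis
    by (rule regular_languageI[of A _ \<phi>]) (use \<phi> in blast)+
qed

lemma regular_language_union:
  assumes "regular_language A L" "regular_language A L'"
  shows "regular_language A (L \<union> L')"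
proof -
  have "L \<subseteq> lists A" "L' \<subseteq> lists A"
    using assms by (auto simp: regular_language_def)
  then have "L \<union> L' = lists A - ((lists A - L) \<inter> (lists A - L'))"
    by blast
  then show ?thesis
    using assms by (simp add: regular_language_inter regular_language_compl)
qed

lemma regular_language_Diff_UN:
  assumes "finite I" "regular_language A L" "\<And>i. i \<in> I \<Longrightarrow> regular_language A (M i)"
  shows "regular_language A (L - (\<Union>i\<in>I. M i))"
  using assms(1,3)
proof (induction I rule: finite_induct)
  case empty
  then show ?case using assms(2) by simp
next
  case (insert i I)
  have "L - (\<Union>j\<in>insert i I. M j) = (L - (\<Union>j\<in>I. M j)) \<inter> (lists A - M i)"
    using assms(2) by (auto simp: regular_language_def)
  then show ?case
    using insert by (simp add: regular_language_inter regular_language_compl)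
qed

lemma finite_lists_bounded:
  assumes "finite A"
  shows "finite {w \<in> lists A. length w \<le> n}"
  using finite_lists_length_le[OF assms, of n] by (simp add: lists_eq_set)

lemma finite_take_image:
  assumes "finite A"
  shows "finite (take n ` lists A)"
  by (rule finite_subset[OF _ finite_lists_bounded[OF assms, of n]])
    (auto dest: in_set_takeD)

lemma take_snoc_cong:
  assumes "take n u = take n v"
  shows "take n (u @ [a]) = take n (v @ [a])"
proof -
  have *: "take n (w @ [a]) = take n (take n w @ [a])" for w :: "'a list"
    by (cases "n \<le> length w") auto
  show ?thesis
    by (subst (1 2) *) (simp add: assms)
qed

lemma eq_of_take_eq:
  assumes "take n u = take n v" "length u < n"
  shows "u = v"
proof -
  have "take n u = u" "length (take n v) = min (length v) n"
    using assms(2) by auto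
  then show ?thesis
    using assms by (metis min_less_iff_conj nat_less_le take_all min_def)
qed

text \<open>The first \<open>n\<close> letters form a finite invariant. When \<open>n\<close>
  exceeds every length in \<open>L\<close>, a word of \<open>L\<close> equals its truncation, and no
  other word has that truncation.\<close>

lemma regular_language_finite:
  assumes "finite A" "finite L" "L \<subseteq> lists A"
  shows "regular_language A L"
proof -
  define n where "n = Suc (Max (insert 0 (length ` L)))"
  have n: "length w < n" if "w \<in> L" for w
    using that assms(2) by (auto simp: n_def less_Suc_eq_le)
  show ?thesis
  proof (rule regular_languageI[of A _ "take n"])
    show "v \<in> L" if "u \<in> L" "take n u = take n v" for u v
      using that n[of u] eq_of_take_eq by blast
    show "take n (u @ [a]) = take n (v @ [a])" if "take n u = take n v" for u v a
      using take_snoc_cong[OF that] .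
  qed (use assms in \<open>simp_all add: finite_take_image\<close>)
qed

text \<open>One extra bit suffices, lost for ever once a prefix has entered \<open>L\<close>. As
  \<open>take i w\<close> is \<open>w\<close> itself for large \<open>i\<close>, the whole word is
  tested too.\<close>

lemma regular_language_no_prefix:
  assumes "regular_language A L"
  shows "regular_language A {w \<in> lists A. \<forall>i. take i w \<notin> L}"
proof -
  obtain \<phi> :: "'a list \<Rightarrow> nat" where \<phi>: "finite A" "finite (\<phi> ` lists A)"
    "\<And>u v a. \<lbrakk>u \<in> lists A; v \<in> lists A; a \<in> A; \<phi> u = \<phi> v\<rbrakk> \<Longrightarrow> \<phi> (u @ [a]) = \<phi> (v @ [a])"
    "\<And>u v. \<lbrakk>u \<in> lists A; v \<in> lists A; \<phi> u = \<phi> v\<rbrakk> \<Longrightarrow> u \<in> L \<longleftrightarrow> v \<in> L"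
    using regular_languageE[OF assms] by metis
  define ok where "ok w \<longleftrightarrow> (\<forall>i. take i w \<notin> L)" for w
  have ok: "ok (w @ [a]) \<longleftrightarrow> ok w \<and> w @ [a] \<notin> L" for w a
  proof
    assume *: "ok (w @ [a])"
    have "take i w \<notin> L" for i
      using *[unfolded ok_def, rule_format, of "min i (length w)"] by (cases "i \<le> length w") auto
    then show "ok w \<and> w @ [a] \<notin> L"
      using *[unfolded ok_def, rule_format, of "Suc (length w)"] by (auto simp: ok_def)
  next
    assume *: "ok w \<and> w @ [a] \<notin> L"
    show "ok (w @ [a])"
      unfolding ok_def
    proof
      fix i
      show "take i (w @ [a]) \<notin> L"
        using * by (cases "i \<le> length w") (auto simp: ok_def)
    qed
  qed
  show ?thesis
  proof (rule regular_languageI[of A _ "\<lambda>w. (\<phi> w, ok w)"])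
    show "finite ((\<lambda>w. (\<phi> w, ok w)) ` lists A)"
      by (rule finite_subset[of _ "\<phi> ` lists A \<times> UNIV"]) (use \<phi>(2) in auto)
    fix u v a
    assume *: "u \<in> lists A" "v \<in> lists A" "a \<in> A" "(\<phi> u, ok u) = (\<phi> v, ok v)"
    then have "\<phi> (u @ [a]) = \<phi> (v @ [a])"
      using \<phi>(3)[of u v a] by blast
    then show "(\<phi> (u @ [a]), ok (u @ [a])) = (\<phi> (v @ [a]), ok (v @ [a]))"
      using * \<phi>(4)[of "u @ [a]" "v @ [a]"] by (simp add: ok)
  qed (use \<phi>(1) in \<open>auto simp: ok_def\<close>)
qed

section \<open>Words in a group\<close>

lemma shortlex_length: "(v, w) \<in> shortlex r \<Longrightarrow> length v \<le> length w"
  by (auto simp: shortlex_def lenlex_conv)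

lemma shortlex_shorter: "length v < length w \<Longrightarrow> (v, w) \<in> shortlex r"
  by (auto simp: shortlex_def lenlex_conv)

lemma lex_snoc:
  assumes "length v = length w"
  shows "(v @ [y], w @ [x]) \<in> lex r \<longleftrightarrow> (v, w) \<in> lex r \<or> v = w \<and> (y, x) \<in> r"
  using assms by (induction v w rule: list_induct2) auto

lemma shortlex_snoc:
  assumes "length v = length w"
  shows "(v @ [y], w @ [x]) \<in> shortlex r \<longleftrightarrow> (v, w) \<in> shortlex r \<or> v = w \<and> (y, x) \<in> r - Id"
  using assms by (simp add: shortlex_def lenlex_conv lex_snoc del: Diff_iff)

locale word_group = group G for G :: "('a, 'b) monoid_scheme" (structure) +
  fixes A :: "'a set"
  assumes finite_A: "finite A"
    and A_carrier: "A \<subseteq> carrier G"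
    and A_inv: "x \<in> A \<Longrightarrow> inv x \<in> A"
    and A_gen: "g \<in> carrier G \<Longrightarrow> \<exists>w \<in> lists A. word_eval G w = g"
begin

abbreviation ev :: "'a list \<Rightarrow> 'a" where "ev \<equiv> word_eval G"

lemma ev_Nil [simp]: "ev [] = \<one>"
  by (simp add: word_eval_def)

lemma ev_Cons [simp]: "ev (a # w) = a \<otimes> ev w"
  by (simp add: word_eval_def)

lemma lists_set: "w \<in> lists A \<Longrightarrow> set w \<subseteq> carrier G"
  using A_carrier by auto

lemma ev_closed [simp, intro]: "w \<in> lists A \<Longrightarrow> ev w \<in> carrier G"
  using word_eval_append(1) lists_set by blast

lemma ev_append [simp]: "u \<in> lists A \<Longrightarrow> v \<in> lists A \<Longrightarrow> ev (u @ v) = ev u \<otimes> ev v"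
  using word_eval_append(2) lists_set by blast

lemma A_closed [simp, intro]: "x \<in> A \<Longrightarrow> x \<in> carrier G"
  using A_carrier by blast

lemma take_lists [simp, intro]: "w \<in> lists A \<Longrightarrow> take i w \<in> lists A"
  by (auto dest: in_set_takeD)

lemma drop_lists [simp, intro]: "w \<in> lists A \<Longrightarrow> drop i w \<in> lists A"
  by (auto dest: in_set_dropD)

lemma ev_take_drop: "w \<in> lists A \<Longrightarrow> ev (take i w) \<otimes> ev (drop i w) = ev w"
  using ev_append[of "take i w" "drop i w"] by simp

lemma ev_snoc: "w \<in> lists A \<Longrightarrow> x \<in> A \<Longrightarrow> ev (w @ [x]) = ev w \<otimes> x"
  by simp

text \<open>Two paths run at the same speed, \<open>v\<close> from \<open>\<one>\<close> and
  \<open>w\<close> from \<open>h\<close>; since \<open>take\<close> saturates, a finished word waits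
  at its end. For finite \<open>F\<close> this is the synchronous fellow traveller property.\<close>

definition fellow :: "'a set \<Rightarrow> 'a \<Rightarrow> 'a list \<Rightarrow> 'a list \<Rightarrow> bool" where
  "fellow F h v w \<longleftrightarrow> (\<forall>i. inv (ev (take i v)) \<otimes> h \<otimes> ev (take i w) \<in> F)"

text \<open>The end condition says \<open>ev v = h \<otimes> ev w \<otimes> inv k\<close>. For
  \<open>h = k = \<one>\<close> a smaller word for the same element is sought, for
  \<open>h = k = inv s\<close> a smaller word for the conjugate by \<open>s\<close>.\<close>

definition beaten :: "('a \<times> 'a) set \<Rightarrow> 'a set \<Rightarrow> 'a \<Rightarrow> 'a \<Rightarrow> 'a list set" where
  "beaten r F h k = {w \<in> lists A. \<exists>v \<in> lists A. fellow F h v w \<and> (v, w) \<in> shortlex r \<and>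
     inv (ev v) \<otimes> h \<otimes> ev w = k}"

lemma fellow_last: "fellow F h v w \<Longrightarrow> inv (ev v) \<otimes> h \<otimes> ev w \<in> F"
  unfolding fellow_def by (metis nle_le take_all)

lemma fellow_snoc1:
  assumes "length v \<le> length w"
  shows "fellow F h v (w @ [x]) \<longleftrightarrow> fellow F h v w \<and> inv (ev v) \<otimes> h \<otimes> ev (w @ [x]) \<in> F"
proof
  assume *: "fellow F h v (w @ [x])"
  have "inv (ev (take i v)) \<otimes> h \<otimes> ev (take i w) \<in> F" for i
    using *[unfolded fellow_def, rule_format, of "min i (length w)"] assms
    by (cases "i \<le> length w") auto
  then show "fellow F h v w \<and> inv (ev v) \<otimes> h \<otimes> ev (w @ [x]) \<in> F"
    using fellow_last[OF *] by (simp add: fellow_def)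
next
  assume *: "fellow F h v w \<and> inv (ev v) \<otimes> h \<otimes> ev (w @ [x]) \<in> F"
  show "fellow F h v (w @ [x])"
    unfolding fellow_def
  proof
    fix i
    show "inv (ev (take i v)) \<otimes> h \<otimes> ev (take i (w @ [x])) \<in> F"
      using * assms by (cases "i \<le> length w") (auto simp: fellow_def)
  qed
qed

lemma fellow_snoc2:
  assumes "length v = length w"
  shows "fellow F h (v @ [y]) (w @ [x]) \<longleftrightarrow>
    fellow F h v w \<and> inv (ev (v @ [y])) \<otimes> h \<otimes> ev (w @ [x]) \<in> F"
proof
  assume *: "fellow F h (v @ [y]) (w @ [x])"
  have "inv (ev (take i v)) \<otimes> h \<otimes> ev (take i w) \<in> F" for i
    using *[unfolded fellow_def, rule_format, of "min i (length w)"] assms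
    by (cases "i \<le> length w") auto
  then show "fellow F h v w \<and> inv (ev (v @ [y])) \<otimes> h \<otimes> ev (w @ [x]) \<in> F"
    using fellow_last[OF *] by (simp add: fellow_def)
next
  assume *: "fellow F h v w \<and> inv (ev (v @ [y])) \<otimes> h \<otimes> ev (w @ [x]) \<in> F"
  show "fellow F h (v @ [y]) (w @ [x])"
    unfolding fellow_def
  proof
    fix i
    show "inv (ev (take i (v @ [y]))) \<otimes> h \<otimes> ev (take i (w @ [x])) \<in> F"
      using * assms by (cases "i \<le> length w") (auto simp: fellow_def)
  qed
qed

text \<open>Subset construction for an automaton that guesses the smaller word letter by letter and
  remembers its offset from \<^term>\<open>w\<close>; a guess shorter than \<^term>\<open>w\<close> is a finished one.\<close>

definition profile :: "('a \<times> 'a) set \<Rightarrow> 'a set \<Rightarrow> 'a \<Rightarrow> 'a list \<Rightarrow> ('a \<times> bool \<times> bool \<times> bool) set" where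
  "profile r F h w = {(inv (ev v) \<otimes> h \<otimes> ev w, length v = length w, v = w, (v, w) \<in> shortlex r) | v.
     v \<in> lists A \<and> length v \<le> length w \<and> fellow F h v w}"

text \<open>The recorded data suffice to continue any guess: the old offset yields the new one,
  equality of lengths tells whether the guess may still grow, and the last two bits feed
  \<open>shortlex_snoc\<close>. One inclusion is enough, as the hypothesis is symmetric in
  \<open>u\<close> and \<open>w\<close>.\<close>

lemma profile_snoc_subset:
  assumes h: "h \<in> carrier G" and u: "u \<in> lists A" and w: "w \<in> lists A" and x: "x \<in> A"
    and eq: "profile r F h u = profile r F h w"
  shows "profile r F h (u @ [x]) \<subseteq> profile r F h (w @ [x])"
proof
  fix p assume "p \<in> profile r F h (u @ [x])"
  then obtain v where v: "v \<in> lists A" "length v \<le> Suc (length u)" "fellow F h v (u @ [x])"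
    and p: "p = (inv (ev v) \<otimes> h \<otimes> ev (u @ [x]), length v = Suc (length u), v = u @ [x], (v, u @ [x]) \<in> shortlex r)"
    by (auto simp: profile_def)
  have transfer: "\<exists>v'. v' \<in> lists A \<and> length v' \<le> length w \<and> fellow F h v' w \<and>
      inv (ev v') \<otimes> h \<otimes> ev w = inv (ev v) \<otimes> h \<otimes> ev u \<and> (length v' = length w \<longleftrightarrow> length v = length u) \<and>
      (v' = w \<longleftrightarrow> v = u) \<and> ((v', w) \<in> shortlex r \<longleftrightarrow> (v, u) \<in> shortlex r)"
    if "v \<in> lists A" "length v \<le> length u" "fellow F h v u" for v
  proof -
    have "(inv (ev v) \<otimes> h \<otimes> ev u, length v = length u, v = u, (v, u) \<in> shortlex r) \<in> profile r F h w"
      unfolding eq[symmetric] using that by (auto simp: profile_def)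
    then show ?thesis
      by (auto simp: profile_def)
  qed
  show "p \<in> profile r F h (w @ [x])"
  \<comment> \<open>Either the guess is already finished, hence shorter than \<open>u @ [x]\<close>
    and smaller by length alone, or it takes a letter \<open>y\<close> in step with
    \<open>x\<close>.\<close>
  proof (cases "length v \<le> length u")
    case True
    then have f: "fellow F h v u" "inv (ev v) \<otimes> h \<otimes> ev (u @ [x]) \<in> F"
      using v(3) fellow_snoc1 by blast+
    obtain v' where v': "v' \<in> lists A" "length v' \<le> length w" "fellow F h v' w"
      "inv (ev v') \<otimes> h \<otimes> ev w = inv (ev v) \<otimes> h \<otimes> ev u"
      using transfer[OF v(1) True f(1)] by blast
    have g: "inv (ev v') \<otimes> h \<otimes> ev (w @ [x]) = inv (ev v) \<otimes> h \<otimes> ev (u @ [x])"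
      using v'(4) v(1) v'(1) h u w x by (simp add: ev_snoc m_assoc[symmetric])
    moreover have "fellow F h v' (w @ [x])"
      using v'(2,3) g f(2) by (simp add: fellow_snoc1)
    moreover have "v \<noteq> u @ [x]" "v' \<noteq> w @ [x]"
      using True v'(2) by auto
    ultimately show ?thesis
      unfolding profile_def mem_Collect_eq using True v' p
      by (intro exI[of _ v']) (auto simp: shortlex_shorter)
  next
    case False
    then have l: "length v = Suc (length u)"
      using v(2) by simp
    then obtain v0 y where v0: "v = v0 @ [y]" "length v0 = length u"
      by (metis append_butlast_last_id diff_Suc_1 length_butlast list.size(3) nat.distinct(1))
    then have A: "v0 \<in> lists A" "y \<in> A"
      using v(1) by auto
    have f: "fellow F h v0 u" "inv (ev v) \<otimes> h \<otimes> ev (u @ [x]) \<in> F"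
      using v(3) fellow_snoc2[OF v0(2)] by (auto simp: v0(1))
    obtain v' where v': "v' \<in> lists A" "length v' = length w" "fellow F h v' w"
      "inv (ev v') \<otimes> h \<otimes> ev w = inv (ev v0) \<otimes> h \<otimes> ev u"
      "v' = w \<longleftrightarrow> v0 = u" "(v', w) \<in> shortlex r \<longleftrightarrow> (v0, u) \<in> shortlex r"
      using transfer[OF A(1) _ f(1)] v0(2) by auto
    have *: "inv (ev (z @ [y])) \<otimes> h \<otimes> ev (z' @ [x]) = inv y \<otimes> (inv (ev z) \<otimes> h \<otimes> ev z') \<otimes> x"
      if "z \<in> lists A" "z' \<in> lists A" for z z'
      using that A(2) h x by (simp add: ev_snoc inv_mult_group m_assoc del: ev_append)
    have g: "inv (ev (v' @ [y])) \<otimes> h \<otimes> ev (w @ [x]) = inv (ev v) \<otimes> h \<otimes> ev (u @ [x])"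
      unfolding v0(1) using * v'(1,4) A(1) u w by simp
    moreover have "fellow F h (v' @ [y]) (w @ [x])"
      using v'(2,3) g f(2) by (simp add: fellow_snoc2)
    ultimately show ?thesis
      unfolding profile_def mem_Collect_eq p
      using v' A v0 by (intro exI[of _ "v' @ [y]"]) (auto simp: shortlex_snoc)
  qed
qed

text \<open>The offset at the end is itself among those that \<open>fellow\<close> confines to
  \<open>F\<close>, so every profile is a subset of one finite set.\<close>

lemma regular_beaten:
  assumes "finite F" "h \<in> carrier G"
  shows "regular_language A (beaten r F h k)"
proof (rule regular_languageI[of A _ "profile r F h"])
  show "finite (profile r F h ` lists A)"
  proof (rule finite_subset[of _ "Pow (F \<times> UNIV)"])
    show "profile r F h ` lists A \<subseteq> Pow (F \<times> UNIV)"
      by (auto simp: profile_def fellow_last)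
  qed (use assms(1) in auto)
  show "profile r F h (u @ [a]) = profile r F h (v @ [a])"
    if "u \<in> lists A" "v \<in> lists A" "a \<in> A" "profile r F h u = profile r F h v" for u v a
    using that profile_snoc_subset[OF assms(2)] by (metis subset_antisym)
  have beaten: "w \<in> beaten r F h k \<longleftrightarrow> (\<exists>b b'. (k, b, b', True) \<in> profile r F h w)" if "w \<in> lists A" for w
    using that by (auto simp: beaten_def profile_def dest: shortlex_length)
  show "v \<in> beaten r F h k"
    if "u \<in> lists A" "v \<in> lists A" "profile r F h u = profile r F h v" "u \<in> beaten r F h k" for u v
    using that beaten by simp
qed (auto simp: beaten_def finite_A)

end

section \<open>The word metric\<close>

text \<open>Discrete intermediate value argument: if \<open>c\<close> is not yet straddled at time
  \<open>k\<close> but is at \<open>Suc k\<close>, then the last step crosses \<open>c\<close>, so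
  the walk is within \<open>D\<close> of it.\<close>

lemma int_walk_hits:
  fixes a :: "nat \<Rightarrow> int"
  assumes "i \<le> k" and "\<And>j. \<bar>a (Suc j) - a j\<bar> \<le> D"
    and "a i \<le> c \<and> c \<le> a k \<or> a k \<le> c \<and> c \<le> a i"
  shows "\<exists>j. i \<le> j \<and> j \<le> k \<and> \<bar>a j - c\<bar> \<le> D"
  using assms(1,3)
proof (induction k rule: dec_induct)
  case base
  then show ?case
    using assms(2)[of i] by (intro exI[of _ i]) auto
next
  case (step k)
  show ?case
  proof (cases "a i \<le> c \<and> c \<le> a k \<or> a k \<le> c \<and> c \<le> a i")
    case True
    then show ?thesis
      using step.IH le_SucI by blast
  next
    case False
    then have "\<bar>a (Suc k) - c\<bar> \<le> D"
      using step.prems assms(2)[of k] by linarith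
    then show ?thesis
      using step.hyps by (intro exI[of _ "Suc k"]) auto
  qed
qed

lemma (in group) mult_inv_cancel:
  assumes "g \<in> carrier G" "x \<in> carrier G"
  shows "g \<otimes> (inv g \<otimes> x) = x" "inv g \<otimes> (g \<otimes> x) = x"
  using assms by (simp_all add: m_assoc[symmetric])

lemma (in group) conj_int_pow:
  assumes "g \<in> carrier G" "x \<in> carrier G"
  shows "g \<otimes> x [^] (n::int) \<otimes> inv g = (g \<otimes> x \<otimes> inv g) [^] n"
proof -
  have "(\<lambda>x. g \<otimes> x \<otimes> inv g) \<in> hom G G"
    using assms(1) by (auto simp: hom_def m_assoc mult_inv_cancel)
  then show ?thesis
    using hom_int_pow[of _ G G x n] assms(2) is_group by blast
qed

context word_group
begin

definition wlen :: "'a \<Rightarrow> nat" where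
  "wlen g = (LEAST n. \<exists>w \<in> lists A. length w = n \<and> ev w = g)"

lemma wlen_word:
  assumes "g \<in> carrier G"
  obtains w where "w \<in> lists A" "length w = wlen g" "ev w = g"
proof -
  have "\<exists>n. \<exists>w \<in> lists A. length w = n \<and> ev w = g"
    using A_gen[OF assms] by blast
  then have "\<exists>w \<in> lists A. length w = wlen g \<and> ev w = g"
    unfolding wlen_def by (rule LeastI_ex)
  then show ?thesis
    using that by blast
qed

lemma wlen_le: "w \<in> lists A \<Longrightarrow> wlen (ev w) \<le> length w"
  unfolding wlen_def by (rule Least_le) blast

lemma wlen_one [simp]: "wlen \<one> = 0"
  using wlen_le[of "[]"] by simp

lemma wlen_mult:
  assumes "g \<in> carrier G" "h \<in> carrier G"
  shows "wlen (g \<otimes> h) \<le> wlen g + wlen h"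
proof -
  obtain u v where "u \<in> lists A" "length u = wlen g" "ev u = g"
    "v \<in> lists A" "length v = wlen h" "ev v = h"
    using wlen_word assms by metis
  then show ?thesis
    using wlen_le[of "u @ v"] by simp
qed

lemma wlen_inv_le:
  assumes "g \<in> carrier G"
  shows "wlen (inv g) \<le> wlen g"
proof -
  obtain w where w: "w \<in> lists A" "length w = wlen g" "ev w = g"
    using wlen_word assms by blast
  have "rev (map (m_inv G) w) \<in> lists A" "ev (rev (map (m_inv G) w)) = inv (ev w)"
    using w(1) by (induction w) (auto simp: A_inv inv_mult_group)
  then show ?thesis
    using wlen_le[of "rev (map (m_inv G) w)"] w by simp
qed

lemma wlen_inv [simp]: "g \<in> carrier G \<Longrightarrow> wlen (inv g) = wlen g"
  using wlen_inv_le[of g] wlen_inv_le[of "inv g"] by simp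

lemma finite_wlen_ball: "finite {g \<in> carrier G. wlen g \<le> n}"
proof (rule finite_subset)
  show "{g \<in> carrier G. wlen g \<le> n} \<subseteq> ev ` {w \<in> lists A. length w \<le> n}"
    using wlen_word by (smt (verit) image_eqI mem_Collect_eq subsetI)
  show "finite (ev ` {w \<in> lists A. length w \<le> n})"
    using finite_lists_bounded[OF finite_A] by blast
qed

definition gdist :: "'a \<Rightarrow> 'a \<Rightarrow> nat" where
  "gdist p q = wlen (inv p \<otimes> q)"

lemma gdist_sym: "p \<in> carrier G \<Longrightarrow> q \<in> carrier G \<Longrightarrow> gdist p q = gdist q p"
  unfolding gdist_def using wlen_inv[of "inv p \<otimes> q"] by (simp add: inv_mult_group)

lemma gdist_triangle:
  assumes "p \<in> carrier G" "q \<in> carrier G" "s \<in> carrier G"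
  shows "gdist p s \<le> gdist p q + gdist q s"
proof -
  have "inv p \<otimes> s = (inv p \<otimes> q) \<otimes> (inv q \<otimes> s)"
    using assms by (simp add: m_assoc mult_inv_cancel)
  then show ?thesis
    unfolding gdist_def using wlen_mult[of "inv p \<otimes> q" "inv q \<otimes> s"] assms by simp
qed

lemma gdist_one: "g \<in> carrier G \<Longrightarrow> gdist \<one> g = wlen g"
  by (simp add: gdist_def)

lemma gdist_take_le:
  assumes "w \<in> lists A" "i \<le> j"
  shows "gdist (ev (take i w)) (ev (take j w)) \<le> j - i"
proof -
  have "take j w = take i w @ take (j - i) (drop i w)"
    using assms(2) by (metis le_add_diff_inverse take_add)
  then have "ev (take j w) = ev (take i w) \<otimes> ev (take (j - i) (drop i w))"
    using assms(1) by (metis ev_append take_lists drop_lists)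
  then have "gdist (ev (take i w)) (ev (take j w)) = wlen (ev (take (j - i) (drop i w)))"
    using assms(1) by (simp add: gdist_def m_assoc[symmetric])
  also have "\<dots> \<le> j - i"
    using wlen_le[of "take (j - i) (drop i w)"] assms(1) by simp
  finally show ?thesis .
qed

text \<open>On \<open>nat\<close>, \<open>(j - i) + (i - j)\<close> is the absolute difference of
  the two times.\<close>

lemma gdist_take:
  assumes "w \<in> lists A"
  shows "gdist (ev (take i w)) (ev (take j w)) \<le> (j - i) + (i - j)"
  using gdist_take_le[OF assms, of i j] gdist_take_le[OF assms, of j i]
    gdist_sym[of "ev (take i w)" "ev (take j w)"] assms by (cases "i \<le> j") auto

lemma gdist_take_end:
  assumes "w \<in> lists A"
  shows "gdist (ev (take i w)) (ev w) \<le> length w - i"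
proof (cases "i \<le> length w")
  case True
  then show ?thesis
    using gdist_take_le[OF assms True] by simp
next
  case False
  then show ?thesis
    using assms by (simp add: gdist_def)
qed

section \<open>Geodesics and shortlex-least words\<close>

definition geodesic :: "'a list \<Rightarrow> bool" where
  "geodesic w \<longleftrightarrow> w \<in> lists A \<and> length w = wlen (ev w)"

lemma geodesic_lists [simp]: "geodesic w \<Longrightarrow> w \<in> lists A"
  by (simp add: geodesic_def)

lemma geodesic_wlen_take:
  assumes "geodesic w" "i \<le> length w"
  shows "wlen (ev (take i w)) = i"
proof -
  have w: "w \<in> lists A"
    using assms(1) by simp
  have "length w \<le> wlen (ev (take i w)) + wlen (ev (drop i w))"
    using wlen_mult[of "ev (take i w)" "ev (drop i w)"] ev_take_drop[OF w, of i] assms(1) w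
    by (simp add: geodesic_def)
  moreover have "wlen (ev (drop i w)) \<le> length w - i" "wlen (ev (take i w)) \<le> i"
    using wlen_le[of "drop i w"] wlen_le[of "take i w"] w assms(2) by simp_all
  ultimately show ?thesis
    using assms(2) by linarith
qed

lemma geodesic_gdist_end:
  assumes "geodesic w" "i \<le> length w"
  shows "gdist (ev (take i w)) (ev w) = length w - i"
proof -
  have w: "w \<in> lists A"
    using assms(1) by simp
  have "wlen (ev w) \<le> wlen (ev (take i w)) + gdist (ev (take i w)) (ev w)"
    using gdist_triangle[of \<one> "ev (take i w)" "ev w"] w by (simp add: gdist_one)
  then show ?thesis
    using geodesic_wlen_take[OF assms] gdist_take_end[OF w, of i] assms(1)
    by (simp add: geodesic_def)
qed

text \<open>With \<open>S = {ev w}\<close> this describes the normal form of an element, with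
  \<open>S\<close> a conjugacy class the word named by \<open>conj_rep\<close>.\<close>

definition shortlex_least :: "('a \<times> 'a) set \<Rightarrow> 'a set \<Rightarrow> 'a list \<Rightarrow> bool" where
  "shortlex_least r S w \<longleftrightarrow> w \<in> lists A \<and> ev w \<in> S \<and>
     (\<forall>v \<in> lists A. ev v \<in> S \<longrightarrow> v = w \<or> (w, v) \<in> shortlex r)"

lemma shortlex_least_exists:
  assumes r: "linear_order_on A r" and "w0 \<in> lists A" "ev w0 \<in> S"
  obtains w where "shortlex_least r S w"
proof -
  let ?W = "{w \<in> lists A. ev w \<in> S}"
  have "w0 \<in> ?W"
    using assms by simp
  then obtain w where w: "w \<in> ?W" and min: "\<And>v. (v, w) \<in> shortlex r \<Longrightarrow> v \<notin> ?W"
    by (rule wfE_min[OF wf_shortlex[OF r finite_A]]) (rule that)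
  have "v = w \<or> (w, v) \<in> shortlex r" if "v \<in> ?W" for v
    using that w min[of v] total_shortlex[OF r, of v w] by blast
  then show ?thesis
    using w by (intro that[of w]) (auto simp: shortlex_least_def)
qed

lemma shortlex_asym:
  assumes "linear_order_on A r" "(v, w) \<in> shortlex r"
  shows "(w, v) \<notin> shortlex r"
  using wf_not_sym[OF wf_shortlex[OF assms(1) finite_A] assms(2)] .

lemma shortlex_irrefl:
  assumes "linear_order_on A r"
  shows "(w, w) \<notin> shortlex r"
  using wf_not_refl[OF wf_shortlex[OF assms finite_A]] .

lemma shortlex_least_mono:
  "shortlex_least r S w \<Longrightarrow> S' \<subseteq> S \<Longrightarrow> ev w \<in> S' \<Longrightarrow> shortlex_least r S' w"
  by (auto simp: shortlex_least_def)

lemma shortlex_least_geodesic: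
  assumes "shortlex_least r S w"
  shows "geodesic w"
proof -
  have w: "w \<in> lists A" "ev w \<in> S"
    using assms by (auto simp: shortlex_least_def)
  obtain v where v: "v \<in> lists A" "length v = wlen (ev w)" "ev v = ev w"
    using wlen_word[of "ev w"] w(1) by auto
  then have "length w \<le> length v"
    using assms w shortlex_length unfolding shortlex_least_def by (metis order_refl)
  then show ?thesis
    using wlen_le[OF w(1)] v(2) w(1) by (simp add: geodesic_def)
qed

lemma shortlex_append_right:
  "(v, u) \<in> shortlex r \<Longrightarrow> (v @ x, u @ x) \<in> shortlex r"
proof (induction x rule: rev_induct)
  case (snoc a x)
  then have *: "(v @ x, u @ x) \<in> shortlex r" by blast
  then consider "length (v @ x) < length (u @ x)" | "length (v @ x) = length (u @ x)"
    using shortlex_length[OF *] by linarith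
  then show ?case
  proof cases
    case 1
    then show ?thesis by (intro shortlex_shorter) auto
  next
    case 2
    then show ?thesis
      using shortlex_snoc[OF 2, of a a r] * by simp
  qed
qed simp

text \<open>A smaller word for the prefix could be followed by \<open>drop i w\<close>; a common
  suffix keeps the order, so \<open>w\<close> would not be least either.\<close>

lemma shortlex_least_take:
  assumes r: "linear_order_on A r" and w: "shortlex_least r {ev w} w"
  shows "shortlex_least r {ev (take i w)} (take i w)"
proof -
  have wl: "w \<in> lists A"
    using w by (simp add: shortlex_least_def)
  have "v = take i w \<or> (take i w, v) \<in> shortlex r" if v: "v \<in> lists A" "ev v = ev (take i w)" for v
  proof (rule ccontr)
    assume "\<not> ?thesis"
    then have lt: "(v, take i w) \<in> shortlex r"
      using total_shortlex[OF r, of v "take i w"] v wl by auto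
    then have "(v @ drop i w, w) \<in> shortlex r"
      using shortlex_append_right[OF lt, of "drop i w"] by simp
    moreover have "v @ drop i w \<in> lists A" "ev (v @ drop i w) = ev w"
      using v wl ev_take_drop[OF wl, of i] by auto
    ultimately have "(w, w) \<in> shortlex r \<or> (v @ drop i w, w) \<in> shortlex r \<and> (w, v @ drop i w) \<in> shortlex r"
      using w unfolding shortlex_least_def by (metis singletonI)
    then show False
      using shortlex_asym[OF r] shortlex_irrefl[OF r] by blast
  qed
  then show ?thesis
    using wl by (auto simp: shortlex_least_def)
qed

end

section \<open>Fellow travelling along an infinite cyclic subgroup\<close>

locale virtually_Z = word_group G A for G :: "('a, 'b) monoid_scheme" (structure) and A +
  fixes t :: 'a and R :: "'a set"
  assumes t_closed [simp]: "t \<in> carrier G"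
    and t_inj: "t [^] (m::int) = t [^] (n::int) \<Longrightarrow> m = n"
    and t_conj: "g \<in> carrier G \<Longrightarrow> g \<otimes> t \<otimes> inv g \<in> {t, inv t}"
    and finite_R: "finite R" and R_carrier: "R \<subseteq> carrier G"
    and R_cover: "g \<in> carrier G \<Longrightarrow> \<exists>s\<in>R. \<exists>n::int. g = t [^] n \<otimes> s"
begin

section \<open>Orientation, coset representatives and heights\<close>

definition orient :: "'a \<Rightarrow> int" where
  "orient g = (if g \<otimes> t \<otimes> inv g = t then 1 else -1)"

lemma orient_cases: "orient g = 1 \<or> orient g = -1"
  by (simp add: orient_def)

text \<open>Conjugation by \<open>g\<close> is a homomorphism that fixes or inverts
  \<open>t\<close>; with \<open>orient g\<close> an integer sign, both cases become one rule for
  moving powers of \<open>t\<close> past \<open>g\<close>.\<close>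

lemma comm_t_pow:
  assumes "g \<in> carrier G"
  shows "g \<otimes> t [^] (n::int) = t [^] (orient g * n) \<otimes> g"
proof -
  have "g \<otimes> t [^] n \<otimes> inv g = t [^] (orient g * n)"
    using t_conj[OF assms] conj_int_pow[OF assms t_closed, of n]
    by (auto simp: orient_def int_pow_inv int_pow_neg)
  then have "g \<otimes> t [^] n \<otimes> inv g \<otimes> g = t [^] (orient g * n) \<otimes> g"
    by simp
  then show ?thesis
    using assms by (simp add: m_assoc)
qed

definition rep :: "'a \<Rightarrow> 'a" where
  "rep g = (SOME s. s \<in> R \<and> (\<exists>n::int. g = t [^] n \<otimes> s))"

text \<open>As \<open>rep \<one>\<close> may be a nontrivial power of \<open>t\<close>,
  \<open>ht \<one>\<close> need not be 0; heights are therefore compared with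
  \<open>ht \<one>\<close> below.\<close>

definition ht :: "'a \<Rightarrow> int" where
  "ht g = (THE n. g = t [^] n \<otimes> rep g)"

lemma rep_ex: "g \<in> carrier G \<Longrightarrow> rep g \<in> R \<and> (\<exists>n::int. g = t [^] n \<otimes> rep g)"
  unfolding rep_def by (rule someI_ex) (use R_cover in blast)

lemma rep_R: "g \<in> carrier G \<Longrightarrow> rep g \<in> R"
  using rep_ex by blast

lemma rep_closed [simp]: "g \<in> carrier G \<Longrightarrow> rep g \<in> carrier G"
  using rep_R R_carrier by blast

lemma t_pow_cancel:
  assumes "s \<in> carrier G" "t [^] (m::int) \<otimes> s = t [^] (n::int) \<otimes> s"
  shows "m = n"
  using assms t_inj right_cancel[of s "t [^] m" "t [^] n"] by simp

lemma ht_eqI: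
  assumes "g \<in> carrier G" "g = t [^] n \<otimes> rep g"
  shows "ht g = n"
  unfolding ht_def
proof (rule the_equality)
  fix m :: int assume "g = t [^] m \<otimes> rep g"
  then show "m = n"
    using assms t_pow_cancel[of "rep g" m n] by simp
qed (rule assms(2))

lemma ht_rep:
  assumes "g \<in> carrier G"
  shows "g = t [^] ht g \<otimes> rep g"
proof -
  obtain n :: int where n: "g = t [^] n \<otimes> rep g"
    using rep_ex[OF assms] by blast
  then show ?thesis
    using ht_eqI[OF assms n] by simp
qed

text \<open>\<open>R\<close> only covers the cosets of \<open>\<langle>t\<rangle>\<close>, so an
  element may have several candidates in it. A shift by a power of \<open>t\<close> leaves the set
  of candidates unchanged, hence both \<open>SOME\<close> terms pick the same one.\<close>

lemma rep_t_pow [simp]: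
  assumes "g \<in> carrier G"
  shows "rep (t [^] (n::int) \<otimes> g) = rep g"
proof -
  have "(\<exists>m::int. t [^] n \<otimes> g = t [^] m \<otimes> s) \<longleftrightarrow> (\<exists>m::int. g = t [^] m \<otimes> s)" if "s \<in> R" for s
  proof
    assume "\<exists>m::int. t [^] n \<otimes> g = t [^] m \<otimes> s"
    then obtain m :: int where m: "t [^] n \<otimes> g = t [^] m \<otimes> s" by blast
    have "g = t [^] (-n) \<otimes> (t [^] n \<otimes> g)"
      using assms by (simp add: m_assoc[symmetric] int_pow_mult[symmetric])
    also have "\<dots> = t [^] (m - n) \<otimes> s"
      using m that R_carrier by (auto simp: m_assoc[symmetric] int_pow_mult[symmetric])
    finally show "\<exists>m::int. g = t [^] m \<otimes> s" by blast
  next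
    assume "\<exists>m::int. g = t [^] m \<otimes> s"
    then obtain m :: int where "g = t [^] m \<otimes> s" by blast
    then have "t [^] n \<otimes> g = t [^] (n + m) \<otimes> s"
      using that R_carrier by (auto simp: m_assoc[symmetric] int_pow_mult)
    then show "\<exists>m::int. t [^] n \<otimes> g = t [^] m \<otimes> s" by blast
  qed
  then have "(s \<in> R \<and> (\<exists>m::int. t [^] n \<otimes> g = t [^] m \<otimes> s)) = (s \<in> R \<and> (\<exists>m::int. g = t [^] m \<otimes> s))" for s
    by blast
  then show ?thesis
    unfolding rep_def by simp
qed

lemma ht_t_pow [simp]:
  assumes "g \<in> carrier G"
  shows "ht (t [^] (n::int) \<otimes> g) = n + ht g"
proof (rule ht_eqI)
  have "t [^] n \<otimes> (t [^] ht g \<otimes> rep g) = t [^] (n + ht g) \<otimes> rep g"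
    using assms by (simp add: m_assoc int_pow_mult)
  then show "t [^] n \<otimes> g = t [^] (n + ht g) \<otimes> rep (t [^] n \<otimes> g)"
    unfolding ht_rep[OF assms, symmetric] rep_t_pow[OF assms] .
qed (use assms in simp)

text \<open>Right multiplication commutes with left multiplication by powers of \<open>t\<close>, so
  its effect depends on \<open>rep g\<close> only. Hence letters change heights by bounded amounts,
  and an automaton can follow the coset together with a residue of the height.\<close>

lemma ht_rep_mult:
  assumes "g \<in> carrier G" "h \<in> carrier G"
  shows "ht (g \<otimes> h) = ht g + ht (rep g \<otimes> h)" "rep (g \<otimes> h) = rep (rep g \<otimes> h)"
proof -
  have "g \<otimes> h = t [^] ht g \<otimes> (rep g \<otimes> h)"
    using ht_rep[OF assms(1)] assms by (metis int_pow_closed m_assoc rep_closed t_closed)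
  then show "ht (g \<otimes> h) = ht g + ht (rep g \<otimes> h)" "rep (g \<otimes> h) = rep (rep g \<otimes> h)"
    using assms by (metis ht_t_pow rep_t_pow m_closed rep_closed)+
qed

lemma ht_step_bound:
  obtains D where "D > 0" "\<And>g x. g \<in> carrier G \<Longrightarrow> x \<in> insert \<one> A \<Longrightarrow> \<bar>ht (g \<otimes> x) - ht g\<bar> \<le> D"
proof
  let ?S = "(\<lambda>(s, x). \<bar>ht (s \<otimes> x)\<bar>) ` (R \<times> insert \<one> A)"
  have fin: "finite (insert 1 ?S)"
    using finite_R finite_A by blast
  show "Max (insert 1 ?S) > 0"
    using Max_ge[OF fin, of 1] by simp
  show "\<bar>ht (g \<otimes> x) - ht g\<bar> \<le> Max (insert 1 ?S)" if "g \<in> carrier G" "x \<in> insert \<one> A" for g x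
  proof -
    have "x \<in> carrier G"
      using that by auto
    then show ?thesis
      using that ht_rep_mult(1)[of g x] rep_R[of g] by (intro Max_ge[OF fin]) force
  qed
qed

text \<open>\<open>inv a \<otimes> b\<close> is
  \<open>inv (rep a) \<otimes> t [^] (ht b - ht a) \<otimes> rep b\<close>, which takes finitely
  many values when the exponent is bounded.\<close>

lemma ht_close:
  obtains D where "\<And>a b. \<lbrakk>a \<in> carrier G; b \<in> carrier G; \<bar>ht a - ht b\<bar> \<le> E\<rbrakk> \<Longrightarrow> gdist a b \<le> D"
proof
  let ?S = "(\<lambda>(s, s', n::int). wlen (inv s \<otimes> t [^] n \<otimes> s')) ` (R \<times> R \<times> {-E..E})"
  have fin: "finite ?S"
    using finite_R by blast
  show "gdist a b \<le> Max ?S" if a: "a \<in> carrier G" and b: "b \<in> carrier G" and "\<bar>ht a - ht b\<bar> \<le> E" for a b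
  proof (rule Max_ge[OF fin])
    have "inv a \<otimes> b = inv (t [^] ht a \<otimes> rep a) \<otimes> (t [^] ht b \<otimes> rep b)"
      using ht_rep a b by metis
    also have "\<dots> = inv (rep a) \<otimes> (t [^] (- ht a) \<otimes> t [^] ht b) \<otimes> rep b"
      using a b by (simp add: inv_mult_group m_assoc int_pow_neg)
    also have "\<dots> = inv (rep a) \<otimes> t [^] (ht b - ht a) \<otimes> rep b"
      by (simp add: int_pow_mult[symmetric])
    finally have "gdist a b = (\<lambda>(s, s', n::int). wlen (inv s \<otimes> t [^] n \<otimes> s')) (rep a, rep b, ht b - ht a)"
      by (simp add: gdist_def)
    moreover have "(rep a, rep b, ht b - ht a) \<in> R \<times> R \<times> {-E..E}"
      using that rep_R by auto
    ultimately show "gdist a b \<in> ?S"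
      by (rule image_eqI)
  qed
qed

text \<open>The bottleneck property of a two-ended group: a path cannot change height without coming
  close to every element of an intermediate height.\<close>

lemma crossing:
  obtains D where "\<And>w c i k. \<lbrakk>w \<in> lists A; c \<in> carrier G; i \<le> k;
     ht (ev (take i w)) \<le> ht c \<and> ht c \<le> ht (ev (take k w)) \<or>
     ht (ev (take k w)) \<le> ht c \<and> ht c \<le> ht (ev (take i w))\<rbrakk> \<Longrightarrow>
     \<exists>j. i \<le> j \<and> j \<le> k \<and> gdist (ev (take j w)) c \<le> D"
proof -
  obtain E where E: "E > 0" "\<And>g x. g \<in> carrier G \<Longrightarrow> x \<in> insert \<one> A \<Longrightarrow> \<bar>ht (g \<otimes> x) - ht g\<bar> \<le> E"
    using ht_step_bound by blast
  obtain D where D: "\<And>a b. \<lbrakk>a \<in> carrier G; b \<in> carrier G; \<bar>ht a - ht b\<bar> \<le> E\<rbrakk> \<Longrightarrow> gdist a b \<le> D"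
    using ht_close by blast
  show ?thesis
  proof (rule that[of D])
    fix w c and i k :: nat
    assume w: "w \<in> lists A" and c: "c \<in> carrier G" and "i \<le> k" and
      between: "ht (ev (take i w)) \<le> ht c \<and> ht c \<le> ht (ev (take k w)) \<or>
        ht (ev (take k w)) \<le> ht c \<and> ht c \<le> ht (ev (take i w))"
    have step: "\<bar>ht (ev (take (Suc j) w)) - ht (ev (take j w))\<bar> \<le> E" for j
    proof (cases "j < length w")
      case True
      then have "w ! j \<in> A"
        using w by auto
      then have "ev (take (Suc j) w) = ev (take j w) \<otimes> w ! j"
        using True w by (simp add: take_Suc_conv_app_nth)
      then show ?thesis
        using E(2)[of "ev (take j w)" "w ! j"] w \<open>w ! j \<in> A\<close> by simp
    next
      case False
      then show ?thesis
        using E(1) by simp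
    qed
    obtain j where "i \<le> j" "j \<le> k" "\<bar>ht (ev (take j w)) - ht c\<bar> \<le> E"
      using int_walk_hits[OF \<open>i \<le> k\<close>, of "\<lambda>j. ht (ev (take j w))", OF step between] by blast
    then show "\<exists>j. i \<le> j \<and> j \<le> k \<and> gdist (ev (take j w)) c \<le> D"
      using D[OF ev_closed[OF take_lists[OF w]] c] by blast
  qed
qed

text \<open>If the height of the point of \<open>v\<close> lies between those of the ends,
  \<open>crossing\<close> brings \<open>u\<close> close to that point, and comparing lengths shows
  that this happens at about the same time. Otherwise \<open>v\<close> passes near one of its ends
  at a time which, \<open>v\<close> being geodesic, places the point itself near that end.\<close>

lemma fellow_travel:
  obtains D where "\<And>u v i. \<lbrakk>geodesic v; u \<in> lists A; ev u = ev v; length u \<le> length v + E\<rbrakk> \<Longrightarrow>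
     gdist (ev (take i v)) (ev (take i u)) \<le> D"
proof -
  obtain D where D: "\<And>w c i k. \<lbrakk>w \<in> lists A; c \<in> carrier G; i \<le> k;
     ht (ev (take i w)) \<le> ht c \<and> ht c \<le> ht (ev (take k w)) \<or>
     ht (ev (take k w)) \<le> ht c \<and> ht c \<le> ht (ev (take i w))\<rbrakk> \<Longrightarrow>
     \<exists>j. i \<le> j \<and> j \<le> k \<and> gdist (ev (take j w)) c \<le> D"
    using crossing by blast
  show ?thesis
  proof (rule that[of "E + 2 * D"])
    fix u v :: "'a list" and i
    assume v: "geodesic v" and u: "u \<in> lists A" and uv: "ev u = ev v" and len: "length u \<le> length v + E"
    let ?g = "ev v" and ?p = "ev (take i v)"
    have vl: "v \<in> lists A"
      using v by simp
    have cl: "?g \<in> carrier G" "ev (take j v) \<in> carrier G" "ev (take j u) \<in> carrier G" for j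
      using u vl by auto
    have len': "length v \<le> length u"
      using wlen_le[OF u] v uv by (simp add: geodesic_def)
    have u_end: "gdist (ev (take j u)) ?g \<le> length u - j" for j
      using gdist_take_end[OF u, of j] uv by simp
    have near_end: "gdist ?p (ev (take i u)) \<le> E + 2 * D" if "length v - i \<le> D"
    proof -
      have "gdist ?p ?g \<le> D"
        using gdist_take_end[OF vl, of i] that by linarith
      moreover have "gdist ?g (ev (take i u)) \<le> E + D"
        using u_end[of i] gdist_sym[of ?g "ev (take i u)"] cl len that by auto
      ultimately show ?thesis
        using gdist_triangle[of ?p ?g "ev (take i u)"] cl by fastforce
    qed
    show "gdist ?p (ev (take i u)) \<le> E + 2 * D"
    proof (cases "i < length v")
      case False
      then show ?thesis
        using near_end by simp
    next
      case i: True
      \<comment> \<open>The cases ask which of the heights of \<open>?p\<close>, of the end and of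
        the start lies in the middle.\<close>
      consider "ht \<one> \<le> ht ?p \<and> ht ?p \<le> ht ?g \<or> ht ?g \<le> ht ?p \<and> ht ?p \<le> ht \<one>"
        | "ht \<one> \<le> ht ?g \<and> ht ?g \<le> ht ?p \<or> ht ?p \<le> ht ?g \<and> ht ?g \<le> ht \<one>"
        | "ht ?p \<le> ht \<one> \<and> ht \<one> \<le> ht ?g \<or> ht ?g \<le> ht \<one> \<and> ht \<one> \<le> ht ?p"
        by linarith
      then show ?thesis
      proof cases
        case 1
        \<comment> \<open>\<open>u\<close> is close to \<open>?p\<close> at time \<open>j\<close>.
          The point \<open>?p\<close> has distance \<open>i\<close> from the start and
          \<open>length v - i\<close> from the end, so \<open>j\<close> differs from
          \<open>i\<close> by at most \<open>D + E\<close>.\<close>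
        then obtain j where j: "j \<le> length u" "gdist (ev (take j u)) ?p \<le> D"
          using D[OF u cl(2), of 0 "length u" i] uv by auto
        have sym: "gdist ?p (ev (take j u)) \<le> D"
          using j(2) gdist_sym cl by metis
        have "i = gdist \<one> ?p"
          using geodesic_wlen_take[OF v, of i] i cl by (simp add: gdist_one)
        also have "\<dots> \<le> wlen (ev (take j u)) + D"
          using gdist_triangle[of \<one> "ev (take j u)" ?p] j(2) cl by (simp add: gdist_one)
        also have "\<dots> \<le> j + D"
          using wlen_le[of "take j u"] u j(1) by simp
        finally have 1: "i \<le> j + D" .
        have "length v - i = gdist ?p ?g"
          using geodesic_gdist_end[OF v, of i] i by simp
        also have "\<dots> \<le> D + (length u - j)"
          using gdist_triangle[of ?p "ev (take j u)" ?g] sym u_end[of j] cl by fastforce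
        finally have "j \<le> i + D + E"
          using len i j(1) by linarith
        then have "gdist (ev (take j u)) (ev (take i u)) \<le> D + E"
          using gdist_take[OF u, of j i] 1 by linarith
        then show ?thesis
          using gdist_triangle[of ?p "ev (take j u)" "ev (take i u)"] sym cl by fastforce
      next
        case 2
        \<comment> \<open>By time \<open>i\<close> the path \<open>v\<close> has already been within
          \<open>D\<close> of its end, so a geodesic has at most \<open>D\<close> letters
          left.\<close>
        then obtain j where j: "j \<le> i" "gdist (ev (take j v)) ?g \<le> D"
          using D[OF vl cl(1), of 0 i] by auto
        then have "length v - i \<le> D"
          using geodesic_gdist_end[OF v, of j] i by linarith
        then show ?thesis
          by (rule near_end)
      next
        case 3
        \<comment> \<open>\<open>v\<close> is within \<open>D\<close> of the start at a time
          \<open>j \<ge> i\<close>; this distance equals \<open>j\<close>, so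
          \<open>i \<le> D\<close> and neither path has gone far by time \<open>i\<close>.\<close>
        then obtain j where j: "i \<le> j" "j \<le> length v" "gdist (ev (take j v)) \<one> \<le> D"
          using D[OF vl one_closed, of i "length v"] i by auto
        then have "i \<le> D"
          using geodesic_wlen_take[OF v, of j] gdist_sym[OF cl(2) one_closed, of j] cl
          by (simp add: gdist_one)
        then have "wlen ?p \<le> D" "wlen (ev (take i u)) \<le> D"
          using wlen_le[of "take i v"] wlen_le[of "take i u"] u vl by auto
        then show ?thesis
          using gdist_triangle[of ?p \<one> "ev (take i u)"] gdist_sym[of ?p \<one>] cl
          by (simp add: gdist_one)
      qed
    qed
  qed
qed

text \<open>Surrounded by fixed words for \<open>h\<close> and \<open>k\<close>, \<open>w\<close>
  becomes a word for \<open>ev v\<close> that is too long by a bounded amount only, so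
  \<open>fellow_travel\<close> applies. The word for \<open>h\<close> merely delays the
  path.\<close>

lemma conj_fellow_travel:
  assumes h: "h \<in> carrier G" and k: "k \<in> carrier G"
  obtains F where "finite F" "\<And>v w. \<lbrakk>geodesic v; w \<in> lists A; ev v = h \<otimes> ev w \<otimes> k;
    length w \<le> length v + E\<rbrakk> \<Longrightarrow> fellow F h v w"
proof -
  obtain x where x: "x \<in> lists A" "ev x = h"
    using A_gen[OF h] by blast
  obtain y where y: "y \<in> lists A" "ev y = k"
    using A_gen[OF k] by blast
  obtain D where D: "\<And>u v i. \<lbrakk>geodesic v; u \<in> lists A; ev u = ev v;
      length u \<le> length v + (E + length x + length y)\<rbrakk> \<Longrightarrow> gdist (ev (take i v)) (ev (take i u)) \<le> D"
    using fellow_travel by blast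
  show ?thesis
  proof (rule that[of "{g \<in> carrier G. wlen g \<le> D + (length x + length y)}"])
    fix v w
    assume v: "geodesic v" and w: "w \<in> lists A" and vw: "ev v = h \<otimes> ev w \<otimes> k"
      and len: "length w \<le> length v + E"
    define u where "u = x @ w @ y"
    have u: "u \<in> lists A" "ev u = ev v" "length u \<le> length v + (E + length x + length y)"
      using x y w h k vw len by (auto simp: u_def m_assoc)
    have vl: "v \<in> lists A"
      using v by simp
    show "fellow {g \<in> carrier G. wlen g \<le> D + (length x + length y)} h v w"
      unfolding fellow_def
    proof
      fix i
      \<comment> \<open>At time \<open>?j\<close> the word \<open>u\<close> has read
        \<open>x\<close> and \<open>i\<close> letters of \<open>w\<close>; \<open>?i\<close> caps
        \<open>i\<close> at the end of \<open>u\<close>, so the two times differ by at most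
        \<open>length x + length y\<close>.\<close>
      let ?j = "length x + min i (length w)" and ?i = "min i (length u)"
      have "take ?j u = x @ take i w"
        by (simp add: u_def min_def)
      then have j: "ev (take ?j u) = h \<otimes> ev (take i w)"
        using x w by simp
      have "take ?i u = take i u"
        by (simp add: min_def)
      moreover have "(?j - ?i) + (?i - ?j) \<le> length x + length y"
        by (auto simp: u_def)
      ultimately have "gdist (ev (take i u)) (ev (take ?j u)) \<le> length x + length y"
        using gdist_take[OF u(1), of ?i ?j] by simp
      then have "gdist (ev (take i v)) (h \<otimes> ev (take i w)) \<le> D + (length x + length y)"
        using gdist_triangle[OF ev_closed[OF take_lists[OF vl, of i]] ev_closed[OF take_lists[OF u(1), of i]]
            ev_closed[OF take_lists[OF u(1), of ?j]]] D[OF v u, of i] unfolding j by linarith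
      then show "inv (ev (take i v)) \<otimes> h \<otimes> ev (take i w)
          \<in> {g \<in> carrier G. wlen g \<le> D + (length x + length y)}"
        using h w vl by (simp add: gdist_def m_assoc)
    qed
  qed (rule finite_wlen_ball)
qed

text \<open>\<open>beaten\<close> is certain to detect a smaller word only for nearly geodesic
  words, so all prefixes are tested. If every prefix of \<open>u\<close> passes, \<open>u\<close> is
  least and so geodesic, and \<open>u @ [x]\<close> is close enough to a geodesic.\<close>

lemma regular_shortlex_least:
  assumes r: "linear_order_on A r"
  shows "regular_language A {w. shortlex_least r {ev w} w}"
proof -
  obtain F where F: "finite F" "\<And>v w. \<lbrakk>geodesic v; w \<in> lists A; ev v = \<one> \<otimes> ev w \<otimes> \<one>;
      length w \<le> length v + 2\<rbrakk> \<Longrightarrow> fellow F \<one> v w"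
    using conj_fellow_travel[OF one_closed one_closed] by blast
  have least: "(\<forall>i. take i w \<notin> beaten r F \<one> \<one>) \<longleftrightarrow> shortlex_least r {ev w} w" if "w \<in> lists A" for w
    using that
  proof (induction w rule: rev_induct)
    case Nil
    have "v = [] \<or> ([], v) \<in> shortlex r" for v
      by (auto simp: shortlex_def)
    then have "shortlex_least r {ev []} []"
      by (auto simp: shortlex_least_def)
    moreover have "([] \<notin> beaten r F \<one> \<one>)"
      by (auto simp: beaten_def shortlex_def)
    ultimately show ?case
      by simp
  next
    case (snoc x u)
    then have A: "u \<in> lists A" "x \<in> A"
      by auto
    show ?case
    proof
      assume *: "\<forall>i. take i (u @ [x]) \<notin> beaten r F \<one> \<one>"
      have "take i u \<notin> beaten r F \<one> \<one>" for i
        using *[rule_format, of "min i (length u)"] by (cases "i \<le> length u") auto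
      then have "shortlex_least r {ev u} u"
        using snoc.IH A by blast
      then have gu: "geodesic u"
        by (rule shortlex_least_geodesic)
      obtain v where v: "shortlex_least r {ev (u @ [x])} v"
        using shortlex_least_exists[OF r snoc.prems] by blast
      then have gv: "geodesic v" and vl: "v \<in> lists A" "ev v = ev (u @ [x])"
        using shortlex_least_geodesic[OF v] v unfolding shortlex_least_def by blast+
      show "shortlex_least r {ev (u @ [x])} (u @ [x])"
      proof (cases "v = u @ [x]")
        case False
        then have lt: "(v, u @ [x]) \<in> shortlex r"
          using v snoc.prems unfolding shortlex_least_def by blast
        \<comment> \<open>Origin of the slack 2: one for the letter \<open>x\<close> itself, one
          because the length of \<open>ev v\<close> may fall below that of \<open>ev u\<close> by
          one.\<close>
        have "ev u = ev v \<otimes> inv x"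
          using vl A by (simp add: m_assoc)
        then have "length u \<le> wlen (ev v) + wlen (inv x)"
          using gu wlen_mult[of "ev v" "inv x"] vl(1) A by (simp add: geodesic_def)
        also have "wlen (inv x) \<le> 1"
          using wlen_le[of "[inv x]"] A A_inv by simp
        finally have "length (u @ [x]) \<le> length v + 2"
          using gv by (simp add: geodesic_def)
        then have "fellow F \<one> v (u @ [x])"
          using F(2)[OF gv snoc.prems] vl(2) ev_closed[OF snoc.prems] by (metis l_one r_one)
        moreover have "inv (ev v) \<otimes> \<one> \<otimes> ev (u @ [x]) = \<one>"
          using vl snoc.prems ev_closed[OF snoc.prems] by (simp del: ev_append)
        ultimately have "u @ [x] \<in> beaten r F \<one> \<one>"
          using vl(1) lt snoc.prems by (auto simp: beaten_def)
        then show ?thesis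
          using *[rule_format, of "length (u @ [x])"] by simp
      qed (use v in simp)
    next
      assume *: "shortlex_least r {ev (u @ [x])} (u @ [x])"
      show "\<forall>i. take i (u @ [x]) \<notin> beaten r F \<one> \<one>"
      proof (intro allI notI)
        fix i
        define z where "z = take i (u @ [x])"
        assume "take i (u @ [x]) \<in> beaten r F \<one> \<one>"
        then have "z \<in> beaten r F \<one> \<one>"
          by (simp only: z_def)
        then obtain v where v: "v \<in> lists A" "(v, z) \<in> shortlex r" "inv (ev v) \<otimes> \<one> \<otimes> ev z = \<one>"
          and z: "z \<in> lists A"
          by (auto simp: beaten_def)
        have "ev v = ev z"
          using v(1,3) z by (metis ev_closed inv_closed inv_equality inv_inv r_one)
        moreover have "shortlex_least r {ev z} z"
          using shortlex_least_take[OF r *, of i] by (simp add: z_def)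
        ultimately have "v = z \<or> (z, v) \<in> shortlex r"
          using v(1) unfolding shortlex_least_def by blast
        then show False
          using v(2) shortlex_asym[OF r] shortlex_irrefl[OF r] by blast
      qed
    qed
  qed
  have "regular_language A {w \<in> lists A. \<forall>i. take i w \<notin> beaten r F \<one> \<one>}"
    using regular_language_no_prefix regular_beaten[OF F(1) one_closed] by blast
  moreover have "{w \<in> lists A. \<forall>i. take i w \<notin> beaten r F \<one> \<one>} = {w. shortlex_least r {ev w} w}"
    using least unfolding shortlex_least_def by blast
  ultimately show ?thesis
    by simp
qed

end

section \<open>Conjugacy\<close>

context word_group
begin

definition conj_class :: "'a \<Rightarrow> 'a set" where
  "conj_class g = {inv x \<otimes> g \<otimes> x | x. x \<in> carrier G}"

lemma conj_classes_eq: "conj_classes G = conj_class ` carrier G"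
  unfolding conj_classes_def conj_class_def by blast

lemma conj_class_carrier: "g \<in> carrier G \<Longrightarrow> conj_class g \<subseteq> carrier G"
  by (auto simp: conj_class_def)

lemma conj_class_refl: "g \<in> carrier G \<Longrightarrow> g \<in> conj_class g"
  unfolding conj_class_def by (force intro: exI[of _ \<one>])

lemma conj_class_sym:
  assumes "g \<in> carrier G" "y \<in> conj_class g"
  shows "g \<in> conj_class y"
proof -
  obtain x where x: "x \<in> carrier G" "y = inv x \<otimes> g \<otimes> x"
    using assms(2) by (auto simp: conj_class_def)
  then have "g = inv (inv x) \<otimes> y \<otimes> inv x"
    using assms(1) by (simp add: m_assoc mult_inv_cancel)
  then show ?thesis
    unfolding conj_class_def using x(1) by blast
qed

lemma conj_class_trans:
  assumes "g \<in> carrier G" "y \<in> conj_class g"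
  shows "conj_class y \<subseteq> conj_class g"
proof
  fix z assume "z \<in> conj_class y"
  then obtain b where b: "b \<in> carrier G" "z = inv b \<otimes> y \<otimes> b"
    by (auto simp: conj_class_def)
  obtain x where x: "x \<in> carrier G" "y = inv x \<otimes> g \<otimes> x"
    using assms(2) by (auto simp: conj_class_def)
  have "z = inv (x \<otimes> b) \<otimes> g \<otimes> (x \<otimes> b)"
    using b x assms(1) by (simp add: m_assoc inv_mult_group)
  then show "z \<in> conj_class g"
    unfolding conj_class_def using b x by blast
qed

lemma conj_class_eq:
  assumes "g \<in> carrier G" "y \<in> conj_class g"
  shows "conj_class y = conj_class g"
  using conj_class_trans conj_class_sym assms conj_class_carrier by (metis subset_antisym subsetD)

lemma conj_rep_eqI:
  assumes "A = sym_gens G X" "linear_order_on A r" "shortlex_least r c w"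
  shows "conj_rep G X r c = w"
proof -
  have "conj_rep G X r c = (THE w. shortlex_least r c w)"
    unfolding conj_rep_def shortlex_least_def assms(1)[symmetric] ..
  also have "\<dots> = w"
  proof (rule the_equality[of "shortlex_least r c", OF assms(3)])
    fix v assume v: "shortlex_least r c v"
    show "v = w"
    proof (rule ccontr)
      assume "v \<noteq> w"
      then have "(v, w) \<in> shortlex r" "(w, v) \<in> shortlex r"
        using v assms(3) unfolding shortlex_least_def by blast+
      then show False
        using shortlex_asym[OF assms(2)] by blast
    qed
  qed
  finally show ?thesis .
qed

text \<open>Each word of the language is the representative of its own class, so the class and the
  definite description can be eliminated.\<close>

lemma ConjSL_eq:
  assumes A: "A = sym_gens G X" and r: "linear_order_on A r"
  shows "ConjSL G X r U = {w. ev w \<in> conj_closure G U \<and> shortlex_least r (conj_class (ev w)) w}"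
proof (intro equalityI subsetI)
  fix w assume "w \<in> ConjSL G X r U"
  then obtain g where g: "g \<in> carrier G" "w = conj_rep G X r (conj_class g)" "ev w \<in> conj_closure G U"
    unfolding ConjSL_def conj_classes_eq by blast
  obtain w0 where w0: "w0 \<in> lists A" "ev w0 = g"
    using A_gen[OF g(1)] by blast
  then have "ev w0 \<in> conj_class g"
    using conj_class_refl[OF g(1)] by simp
  then obtain v where v: "shortlex_least r (conj_class g) v"
    using shortlex_least_exists[OF r w0(1)] by blast
  then have "v = w"
    using conj_rep_eqI[OF A r] g(2) by simp
  moreover have "conj_class (ev v) = conj_class g"
    using v conj_class_eq[OF g(1)] unfolding shortlex_least_def by blast
  ultimately show "w \<in> {w. ev w \<in> conj_closure G U \<and> shortlex_least r (conj_class (ev w)) w}"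
    using v g(3) by simp
next
  fix w assume "w \<in> {w. ev w \<in> conj_closure G U \<and> shortlex_least r (conj_class (ev w)) w}"
  then have w: "ev w \<in> conj_closure G U" "shortlex_least r (conj_class (ev w)) w" "w \<in> lists A"
    by (auto simp: shortlex_least_def)
  then have "w = conj_rep G X r (conj_class (ev w))" "conj_class (ev w) \<in> conj_classes G"
    using conj_rep_eqI[OF A r] by (auto simp: conj_classes_eq)
  then show "w \<in> ConjSL G X r U"
    unfolding ConjSL_def using w(1) by (metis (mono_tags, lifting) mem_Collect_eq)
qed

lemma ConjSL_lists:
  assumes "A = sym_gens G X" "linear_order_on A r"
  shows "ConjSL G X r U \<subseteq> lists A"
  unfolding ConjSL_eq[OF assms] by (auto simp: shortlex_least_def)

end

section \<open>Conjugacy classes by orientation\<close>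

context virtually_Z
begin

lemma orient_eqI:
  assumes "g \<in> carrier G" "g \<otimes> t = t [^] (n::int) \<otimes> g"
  shows "orient g = n"
  using comm_t_pow[OF assms(1), of 1] assms t_pow_cancel[of g "orient g" n] by simp

lemma orient_mult:
  assumes g: "g \<in> carrier G" and h: "h \<in> carrier G"
  shows "orient (g \<otimes> h) = orient g * orient h"
proof (rule orient_eqI)
  have "h \<otimes> t = t [^] orient h \<otimes> h"
    using comm_t_pow[OF h, of 1] by simp
  then have "g \<otimes> h \<otimes> t = g \<otimes> t [^] orient h \<otimes> h"
    using g h by (simp add: m_assoc)
  then show "g \<otimes> h \<otimes> t = t [^] (orient g * orient h) \<otimes> (g \<otimes> h)"
    using comm_t_pow[OF g, of "orient h"] g h by (simp add: m_assoc)
qed (use g h in simp)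

lemma orient_one [simp]: "orient \<one> = 1"
  by (rule orient_eqI) auto

lemma orient_inv [simp]: "g \<in> carrier G \<Longrightarrow> orient (inv g) = orient g"
  using orient_mult[of g "inv g"] orient_cases[of g] by auto

lemma orient_t_pow [simp]: "orient (t [^] (n::int)) = 1"
  by (rule orient_eqI)
    (use int_pow_mult[OF t_closed, of n 1] int_pow_mult[OF t_closed, of 1 n] in \<open>auto simp: add.commute\<close>)

lemma orient_t_pow_mult [simp]: "g \<in> carrier G \<Longrightarrow> orient (t [^] (n::int) \<otimes> g) = orient g"
  by (simp add: orient_mult)

lemma orient_conj [simp]:
  "g \<in> carrier G \<Longrightarrow> x \<in> carrier G \<Longrightarrow> orient (x \<otimes> g \<otimes> inv x) = orient g"
  "g \<in> carrier G \<Longrightarrow> x \<in> carrier G \<Longrightarrow> orient (inv x \<otimes> g \<otimes> x) = orient g"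
  using orient_cases[of x] by (auto simp: orient_mult)

lemma R_closed [simp]: "s \<in> R \<Longrightarrow> s \<in> carrier G"
  using R_carrier by blast

lemma t_pow_conj:
  assumes "g \<in> carrier G" "orient g = 1"
  shows "t [^] (n::int) \<otimes> g \<otimes> inv (t [^] n) = g"
  using comm_t_pow[OF assms(1), of n] assms by (metis int_pow_closed inv_solve_right m_closed mult_1 t_closed)

text \<open>Powers of \<open>t\<close> commute with \<open>g\<close>, so of a conjugator
  \<open>t [^] n \<otimes> s\<close> only \<open>s\<close> has an effect.\<close>

lemma conj_class_orient1:
  assumes "g \<in> carrier G" "orient g = 1"
  shows "conj_class g = {inv s \<otimes> g \<otimes> s | s. s \<in> R}"
proof (intro equalityI subsetI)
  fix y assume "y \<in> conj_class g"
  then obtain x where x: "x \<in> carrier G" "y = inv x \<otimes> g \<otimes> x"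
    by (auto simp: conj_class_def)
  obtain s and n :: int where s: "s \<in> R" "x = t [^] n \<otimes> s"
    using R_cover[OF x(1)] by blast
  have "y = inv s \<otimes> (t [^] (-n) \<otimes> g \<otimes> inv (t [^] (-n))) \<otimes> s"
    unfolding x(2) s(2) using s(1) assms(1) by (simp add: m_assoc inv_mult_group int_pow_neg)
  then have "y = inv s \<otimes> g \<otimes> s"
    using t_pow_conj[OF assms] by simp
  then show "y \<in> {inv s \<otimes> g \<otimes> s | s. s \<in> R}"
    using s(1) by blast
qed (auto simp: conj_class_def)

text \<open>Words already least for their element are geodesic, so one test at the end of the word
  is enough. The equivalence is limited to orientation 1, where finitely many conjugators
  \<open>s \<in> R\<close> exhaust the class.\<close>

lemma regular_conj_least:
  assumes r: "linear_order_on A r"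
  obtains K where "regular_language A K"
    "\<And>w. \<lbrakk>w \<in> lists A; orient (ev w) = 1\<rbrakk> \<Longrightarrow> w \<in> K \<longleftrightarrow> shortlex_least r (conj_class (ev w)) w"
proof -
  \<comment> \<open>The slack \<open>2 * wlen s\<close> is the most by which a geodesic
    \<open>w\<close> can be longer than a geodesic for its conjugate by \<open>s\<close>.\<close>
  have "\<exists>F. finite F \<and> (\<forall>v w. geodesic v \<longrightarrow> w \<in> lists A \<longrightarrow> ev v = inv s \<otimes> ev w \<otimes> s \<longrightarrow>
      length w \<le> length v + 2 * wlen s \<longrightarrow> fellow F (inv s) v w)" if "s \<in> R" for s
    using conj_fellow_travel[of "inv s" s "2 * wlen s"] that R_closed by (metis inv_closed)
  then obtain F where F: "\<And>s. s \<in> R \<Longrightarrow> finite (F s)"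
    "\<And>s v w. \<lbrakk>s \<in> R; geodesic v; w \<in> lists A; ev v = inv s \<otimes> ev w \<otimes> s;
      length w \<le> length v + 2 * wlen s\<rbrakk> \<Longrightarrow> fellow (F s) (inv s) v w"
    by metis
  define K where "K = {w. shortlex_least r {ev w} w} - (\<Union>s\<in>R. beaten r (F s) (inv s) (inv s))"
  have reg: "regular_language A K"
    unfolding K_def using finite_R regular_shortlex_least[OF r] regular_beaten F(1)
    by (intro regular_language_Diff_UN) auto
  show ?thesis
  proof (rule that[OF reg])
    fix w assume w: "w \<in> lists A" and o: "orient (ev w) = 1"
    have wc: "ev w \<in> carrier G"
      using w by simp
    note cl = conj_class_orient1[OF wc o]
    show "w \<in> K \<longleftrightarrow> shortlex_least r (conj_class (ev w)) w"
    proof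
      assume w_K: "w \<in> K"
      then have gw: "geodesic w"
        using shortlex_least_geodesic by (auto simp: K_def)
      obtain v where v: "shortlex_least r (conj_class (ev w)) v"
        using shortlex_least_exists[OF r w conj_class_refl[OF wc]] by blast
      then have gv: "geodesic v" and vl: "v \<in> lists A" and "ev v \<in> conj_class (ev w)"
        using shortlex_least_geodesic[OF v] unfolding shortlex_least_def by blast+
      then obtain s where s: "s \<in> R" "ev v = inv s \<otimes> ev w \<otimes> s"
        unfolding cl by blast
      have vc: "ev v \<in> carrier G"
        using vl by simp
      show "shortlex_least r (conj_class (ev w)) w"
      proof (cases "v = w")
        case False
        then have lt: "(v, w) \<in> shortlex r"
          using v w conj_class_refl[OF wc] unfolding shortlex_least_def by blast
        have "ev w = s \<otimes> ev v \<otimes> inv s"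
          using s wc by (simp add: m_assoc mult_inv_cancel)
        then have "wlen (ev w) \<le> wlen s + wlen (ev v) + wlen s"
          using wlen_mult[of "s \<otimes> ev v" "inv s"] wlen_mult[of s "ev v"] s(1) vc by simp
        then have "fellow (F s) (inv s) v w"
          using F(2)[OF s(1) gv w s(2)] gv gw by (simp add: geodesic_def)
        moreover have "inv (ev v) \<otimes> inv s \<otimes> ev w = inv s"
          using s wc by (simp add: inv_mult_group m_assoc mult_inv_cancel)
        ultimately have "w \<in> beaten r (F s) (inv s) (inv s)"
          using w vl lt unfolding beaten_def by blast
        then show ?thesis
          using w_K s(1) by (auto simp: K_def)
      qed (use v in simp)
    next
      assume least: "shortlex_least r (conj_class (ev w)) w"
      have "w \<notin> beaten r (F s) (inv s) (inv s)" if s: "s \<in> R" for s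
      proof
        assume "w \<in> beaten r (F s) (inv s) (inv s)"
        then obtain v where v: "v \<in> lists A" "(v, w) \<in> shortlex r" "inv (ev v) \<otimes> inv s \<otimes> ev w = inv s"
          unfolding beaten_def by blast
        have "ev v = ev v \<otimes> (inv (ev v) \<otimes> inv s \<otimes> ev w) \<otimes> s"
          unfolding v(3) using s v(1) by (simp add: m_assoc)
        also have "\<dots> = inv s \<otimes> ev w \<otimes> s"
          using s v(1) wc by (simp add: m_assoc mult_inv_cancel)
        finally have "ev v \<in> conj_class (ev w)"
          unfolding cl using s by blast
        then have "v = w \<or> (w, v) \<in> shortlex r"
          using least v(1) unfolding shortlex_least_def by blast
        then show False
          using v(2) shortlex_asym[OF r] shortlex_irrefl[OF r] by blast
      qed
      moreover have "shortlex_least r {ev w} w"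
        using shortlex_least_mono[OF least, of "{ev w}"] conj_class_refl[OF wc] by simp
      ultimately show "w \<in> K"
        by (auto simp: K_def)
    qed
  qed
qed

text \<open>Here \<open>g \<otimes> t [^] k = t [^] (-k) \<otimes> g\<close>, so conjugating by
  \<open>t [^] k\<close> lowers the exponent by \<open>2 * k\<close>; only its parity
  survives.\<close>

lemma finite_conj_classes_reversing:
  "finite {conj_class g | g. g \<in> carrier G \<and> orient g \<noteq> 1}"
proof (rule finite_subset)
  show "{conj_class g | g. g \<in> carrier G \<and> orient g \<noteq> 1} \<subseteq>
      (\<lambda>(n::int, s). conj_class (t [^] n \<otimes> s)) ` ({0, 1} \<times> R)"
  proof clarify
    fix g assume g: "g \<in> carrier G" and "orient g \<noteq> 1"
    then have o: "orient g = -1"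
      using orient_cases by blast
    obtain s and n :: int where s: "s \<in> R" "g = t [^] n \<otimes> s"
      using R_cover[OF g] by blast
    let ?k = "n div 2"
    have "inv (t [^] ?k) \<otimes> g \<otimes> t [^] ?k = t [^] (- ?k) \<otimes> (g \<otimes> t [^] ?k)"
      using g by (simp add: int_pow_neg m_assoc)
    also have "\<dots> = t [^] (- ?k) \<otimes> (t [^] (- ?k) \<otimes> (t [^] n \<otimes> s))"
      using comm_t_pow[OF g, of ?k] o s(2) by simp
    also have "\<dots> = t [^] (- ?k + (- ?k + n)) \<otimes> s"
      using s(1) by (simp only: int_pow_mult[OF t_closed] m_assoc int_pow_closed t_closed m_closed R_closed)
    also have "- ?k + (- ?k + n) = n mod 2"
      by presburger
    finally have "t [^] (n mod 2) \<otimes> s \<in> conj_class g"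
      unfolding conj_class_def by (metis (mono_tags, lifting) int_pow_closed mem_Collect_eq t_closed)
    then have "conj_class g = conj_class (t [^] (n mod 2) \<otimes> s)"
      using conj_class_eq[OF g] by simp
    moreover have "n mod 2 \<in> {0, 1}"
      by auto
    ultimately show "conj_class g \<in> (\<lambda>(n::int, s). conj_class (t [^] n \<otimes> s)) ` ({0, 1} \<times> R)"
      using s(1) by (intro image_eqI[of _ _ "(n mod 2, s)"]) auto
  qed
  show "finite ((\<lambda>(n::int, s). conj_class (t [^] n \<otimes> s)) ` ({0, 1} \<times> R))"
    using finite_R by blast
qed

end

section \<open>Rational subsets\<close>

text \<open>In each residue class modulo \<open>P\<close> the predicate switches on at most once
  past \<open>n0\<close>. So the set \<open>S\<close> of switches injects into the residues and is
  finite, and nothing changes beyond its maximum.\<close>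

lemma upward_closed_eventually_periodic:
  fixes p :: "int \<Rightarrow> bool"
  assumes P: "P > 0" and up: "\<And>n. n \<ge> n0 \<Longrightarrow> p n \<Longrightarrow> p (n + P)"
  shows "\<exists>n1. \<forall>n\<ge>n1. p n \<longleftrightarrow> p (n + P)"
proof -
  have ups: "p (n + int k * P)" if "n \<ge> n0" "p n" for n k
  proof (induction k)
    case (Suc k)
    have "n + int k * P \<ge> n0"
      using that(1) P by (simp add: add_increasing2)
    then show ?case
      using up[of "n + int k * P"] Suc by (simp add: algebra_simps)
  qed (use that in simp)
  define S where "S = {n. n \<ge> n0 \<and> \<not> p n \<and> p (n + P)}"
  have no: False if n: "n \<in> S" and n': "n' \<in> S" and lt: "n < n'" and md: "n mod P = n' mod P" for n n'
  proof -
    obtain q where q: "n' - n = P * q"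
      using md by (metis dvdE mod_eq_dvd_iff)
    then have "q > 0"
      using lt P by (metis diff_gt_0_iff_gt zero_less_mult_pos)
    then have "n' = (n + P) + int (nat (q - 1)) * P"
      using q by (simp add: algebra_simps)
    moreover have "n + P \<ge> n0" "p (n + P)"
      using n P by (auto simp: S_def)
    ultimately have "p n'"
      using ups by metis
    then show False
      using n' by (simp add: S_def)
  qed
  have "inj_on (\<lambda>n. n mod P) S"
    using no by (intro inj_onI) (metis linorder_neqE_linordered_idom)
  moreover have "(\<lambda>n. n mod P) ` S \<subseteq> {0..<P}"
    using P by auto
  ultimately have "finite S"
    by (meson finite_atLeastLessThan_int finite_subset inj_on_finite)
  then have bound: "n \<le> Max (insert 0 S)" if "n \<in> S" for n
    using that by simp
  show ?thesis
  proof (intro exI[of _ "max n0 (Max (insert 0 S) + 1)"] allI impI)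
    fix n assume n: "n \<ge> max n0 (Max (insert 0 S) + 1)"
    then have "n \<notin> S"
      using bound[of n] by auto
    then show "p n \<longleftrightarrow> p (n + P)"
      using n up[of n] by (auto simp: S_def)
  qed
qed

context virtually_Z
begin

text \<open>The sign \<open>e\<close> covers both ends of a coset of
  \<open>\<langle>t\<rangle>\<close>. The threshold may vary with \<open>g\<close>, but
  \<open>P\<close> may not: an automaton is to count heights modulo \<open>P\<close>.\<close>

definition eventually_periodic :: "int \<Rightarrow> 'a set \<Rightarrow> bool" where
  "eventually_periodic P V \<longleftrightarrow> P > 0 \<and>
     (\<forall>g\<in>carrier G. \<exists>n0::int. \<forall>n\<ge>n0. \<forall>e\<in>{1, -1}.
        t [^] (e * n) \<otimes> g \<in> V \<longleftrightarrow> t [^] (e * (n + P)) \<otimes> g \<in> V)"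

lemma ev_pump:
  assumes x: "x \<in> lists A" and z: "z \<in> lists A" and eq: "ev (x @ z) = t [^] (m::int) \<otimes> ev x"
  shows "ev (x @ concat (replicate k z)) = t [^] (m * int k) \<otimes> ev x"
proof (induction k)
  case (Suc k)
  have zk: "concat (replicate k z) \<in> lists A"
    using z by (induction k) auto
  have "concat (replicate (Suc k) z) = concat (replicate k z) @ z"
    by (induction k) auto
  then have "ev (x @ concat (replicate (Suc k) z)) = ev (x @ concat (replicate k z)) \<otimes> ev z"
    using x z zk by (simp add: m_assoc)
  also have "\<dots> = t [^] (m * int k) \<otimes> (ev x \<otimes> ev z)"
    unfolding Suc using x z by (simp add: m_assoc)
  also have "ev x \<otimes> ev z = t [^] m \<otimes> ev x"
    using eq x z by simp
  also have "t [^] (m * int k) \<otimes> (t [^] m \<otimes> ev x) = t [^] (m * int k + m) \<otimes> ev x"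
    using x by (simp add: int_pow_mult m_assoc)
  also have "m * int k + m = m * int (Suc k)"
    by (simp add: algebra_simps)
  finally show ?case .
qed (use x in simp)

text \<open>Among the first times at which the walk of an accepted word reaches sufficiently many
  equidistant heights, two agree in automaton state and coset; the loop between them shifts the
  height by a positive amount below a bound that does not depend on the word.\<close>

lemma rational_pumping:
  assumes L: "regular_language A L"
  obtains P B :: int where "P > 0"
    "\<And>y e. \<lbrakk>y \<in> L; e \<in> {1, -1}; e * ht (ev y) \<ge> e * ht \<one> + B\<rbrakk> \<Longrightarrow> t [^] (e * P) \<otimes> ev y \<in> ev ` L"
proof -
  obtain \<phi> :: "'a list \<Rightarrow> nat" where \<phi>: "L \<subseteq> lists A" "finite (\<phi> ` lists A)"
    "\<And>u v a. \<lbrakk>u \<in> lists A; v \<in> lists A; a \<in> A; \<phi> u = \<phi> v\<rbrakk> \<Longrightarrow> \<phi> (u @ [a]) = \<phi> (v @ [a])"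
    "\<And>u v. \<lbrakk>u \<in> lists A; v \<in> lists A; \<phi> u = \<phi> v\<rbrakk> \<Longrightarrow> u \<in> L \<longleftrightarrow> v \<in> L"
    using regular_languageE[OF L] by metis
  have \<phi>_append: "\<phi> (u @ w) = \<phi> (v @ w)"
    if "u \<in> lists A" "v \<in> lists A" "w \<in> lists A" "\<phi> u = \<phi> v" for u v w
    using that(3)
  proof (induction w rule: rev_induct)
    case (snoc a w)
    then show ?case
      using \<phi>(3)[of "u @ w" "v @ w" a] that(1,2) by simp
  qed (use that in simp)
  obtain D where D: "D > 0" "\<And>g x. g \<in> carrier G \<Longrightarrow> x \<in> insert \<one> A \<Longrightarrow> \<bar>ht (g \<otimes> x) - ht g\<bar> \<le> D"
    using ht_step_bound by blast
  define S where "S = \<phi> ` lists A \<times> R"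
  have fin_S: "finite S"
    unfolding S_def using \<phi>(2) finite_R by blast
  define K where "K = card S"
  \<comment> \<open>The \<open>K + 1\<close> first-passage times belong to levels spaced by
    \<open>D\<close>, and each overshoots its level by less than \<open>D\<close>; so heights at two
    of them differ by at most \<open>B\<close>, and a rise by \<open>B\<close> makes all of them
    occur.\<close>
  define B where "B = (int K + 1) * D"
  \<comment> \<open>A multiple of every possible loop shift \<open>m\<close> with
    \<open>0 < m \<le> B\<close>, so that one period serves all words.\<close>
  define P :: int where "P = fact (nat B)"
  show ?thesis
  proof (rule that[of P B])
    show "P > 0"
      by (simp add: P_def)
    fix y e
    assume yL: "y \<in> L" and e: "e \<in> {1, -1::int}" and high: "e * ht (ev y) \<ge> e * ht \<one> + B"
    have y: "y \<in> lists A"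
      using yL \<phi>(1) by blast
    define a where "a i = e * ht (ev (take i y))" for i
    have step: "a (Suc i) \<le> a i + D" for i
    proof (cases "i < length y")
      case True
      then have yi: "y ! i \<in> A"
        using y by auto
      then have "ev (take (Suc i) y) = ev (take i y) \<otimes> y ! i"
        using True y by (simp add: take_Suc_conv_app_nth)
      then show ?thesis
        using D(2)[of "ev (take i y)" "y ! i"] y yi e by (auto simp: a_def)
    qed (use D(1) in \<open>simp add: a_def\<close>)
    define f where "f j = (LEAST i. a i \<ge> a 0 + int j * D)" for j
    have f: "a (f j) \<ge> a 0 + int j * D" if "j \<le> K" for j
    proof -
      have "int j * D \<le> B"
        unfolding B_def using that D(1) by (intro mult_right_mono) auto
      then have "a (length y) \<ge> a 0 + int j * D"
        using high by (simp add: a_def)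
      then show ?thesis
        unfolding f_def by (rule LeastI)
    qed
    have f_upper: "a (f j) < a 0 + (int j + 1) * D" for j
    proof (cases "f j")
      case 0
      then show ?thesis
        using D(1) by simp
    next
      case (Suc i)
      then have "\<not> a i \<ge> a 0 + int j * D"
        using not_less_Least[of i "\<lambda>i. a i \<ge> a 0 + int j * D"] by (simp add: f_def)
      then show ?thesis
        using step[of i] Suc by (simp add: algebra_simps)
    qed
    have mono: "f j < f j' \<and> a (f j) < a (f j')" if "j < j'" "j' \<le> K" for j j'
    proof -
      have "(int j + 1) * D \<le> int j' * D" "int j * D \<le> int j' * D"
        using that D(1) by (auto intro!: mult_right_mono)
      then have lt: "a (f j) < a (f j')" and "a (f j') \<ge> a 0 + int j * D"
        using f[OF that(2)] f_upper[of j] by linarith+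
      then have "f j \<le> f j'"
        unfolding f_def[of j] by (intro Least_le)
      then show ?thesis
        using lt by (metis le_neq_implies_less less_irrefl)
    qed
    define \<sigma> where "\<sigma> j = (\<phi> (take (f j) y), rep (ev (take (f j) y)))" for j
    have "\<sigma> ` {..K} \<subseteq> S"
      unfolding \<sigma>_def S_def using take_lists[OF y] rep_R ev_closed by blast
    then have "card (\<sigma> ` {..K}) < card {..K}"
      using card_mono[OF fin_S] by (simp add: K_def less_Suc_eq_le)
    then have "\<not> inj_on \<sigma> {..K}"
      by (rule pigeonhole)
    then obtain j j' where j: "j < j'" "j' \<le> K" "\<sigma> j = \<sigma> j'"
      unfolding inj_on_def by (metis atMost_iff linorder_neqE_nat)
    define m where "m = a (f j') - a (f j)"
    have m: "0 < m"
      using mono[OF j(1,2)] by (simp add: m_def)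
    have "(int j' + 1) * D - int j * D \<le> B"
    proof -
      have "(int j' + 1 - int j) * D \<le> (int K + 1) * D"
        using j D(1) by (intro mult_right_mono) auto
      then show ?thesis
        by (simp add: B_def algebra_simps)
    qed
    then have m_le: "m \<le> B"
      using f[of j] f_upper[of j'] j(1,2) by (simp add: m_def)
    then have "nat m dvd fact (nat B)"
      using m by (intro dvd_fact) auto
    then have "int (nat m) dvd int (fact (nat B))"
      by (simp only: int_dvd_int_iff)
    then obtain q where q: "P = m * q"
      using m by (auto simp: P_def dvd_def)
    then have q0: "q > 0"
      using \<open>P > 0\<close> m by (simp add: zero_less_mult_iff)
    define x where "x = take (f j) y"
    define z where "z = drop (f j) (take (f j') y)"
    define u where "u = drop (f j') y"
    have xz: "x @ z = take (f j') y"
      using mono[OF j(1,2)] by (simp add: x_def z_def) (metis append_take_drop_id less_imp_le min.absorb1 take_take)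
    have lists: "x \<in> lists A" "z \<in> lists A" "u \<in> lists A"
      using y by (auto simp: x_def z_def u_def dest: in_set_takeD in_set_dropD)
    have y_eq: "y = x @ z @ u"
      using xz by (metis append.assoc append_take_drop_id u_def)
    have st: "\<phi> (x @ z) = \<phi> x" "rep (ev (x @ z)) = rep (ev x)"
      using j(3) unfolding xz by (simp_all add: \<sigma>_def x_def)
    have "ht (ev (x @ z)) = ht (ev x) + e * m"
      using e unfolding xz by (auto simp: m_def a_def x_def)
    then have "ev (x @ z) = t [^] (e * m + ht (ev x)) \<otimes> rep (ev x)"
      using ht_rep[of "ev (x @ z)"] st(2) lists by (simp add: add.commute)
    also have "\<dots> = t [^] (e * m) \<otimes> (t [^] ht (ev x) \<otimes> rep (ev x))"
      using lists by (simp add: int_pow_mult m_assoc)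
    finally have xz_eq: "ev (x @ z) = t [^] (e * m) \<otimes> ev x"
      using ht_rep[of "ev x"] lists by simp
    \<comment> \<open>The loop already occurs once in \<open>y\<close>; \<open>q\<close> further
      copies shift the height by \<open>e * m * q = e * P\<close>.\<close>
    define k where "k = Suc (nat q)"
    define zk where "zk = concat (replicate k z)"
    have zk: "concat (replicate i z) \<in> lists A" for i
      using lists(2) by (induction i) auto
    have "\<phi> (x @ concat (replicate i z)) = \<phi> x" for i
    proof (induction i)
      case (Suc i)
      have "concat (replicate (Suc i) z) = z @ concat (replicate i z)"
        by simp
      then have "\<phi> (x @ concat (replicate (Suc i) z)) = \<phi> (x @ concat (replicate i z))"
        using \<phi>_append[of "x @ z" x "concat (replicate i z)"] lists zk st(1) by simp
      then show ?case
        using Suc by simp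
    qed simp
    then have "\<phi> (x @ zk) = \<phi> (x @ z)"
      using st(1) by (simp add: zk_def)
    then have "\<phi> ((x @ zk) @ u) = \<phi> y"
      using \<phi>_append[of "x @ zk" "x @ z" u] lists zk[of k] y_eq by (simp add: zk_def)
    then have acc: "(x @ zk) @ u \<in> L"
      using \<phi>(4)[of "(x @ zk) @ u" y] yL y lists zk[of k] by (simp add: zk_def)
    have "ev ((x @ zk) @ u) = ev (x @ zk) \<otimes> ev u"
      using lists zk[of k] by (simp add: zk_def m_assoc)
    also have "ev (x @ zk) = t [^] (e * m * int k) \<otimes> ev x"
      unfolding zk_def by (rule ev_pump[OF lists(1,2) xz_eq])
    also have "e * m * int k = e * P + e * m"
      using q0 by (simp add: k_def q algebra_simps)
    also have "t [^] (e * P + e * m) \<otimes> ev x = t [^] (e * P) \<otimes> ev (x @ z)"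
      unfolding xz_eq using lists by (simp add: int_pow_mult m_assoc)
    also have "t [^] (e * P) \<otimes> ev (x @ z) \<otimes> ev u = t [^] (e * P) \<otimes> ev y"
      unfolding y_eq using lists by (simp add: m_assoc)
    finally show "t [^] (e * P) \<otimes> ev y \<in> ev ` L"
      using acc by (metis imageI)
  qed
qed

text \<open>Pumping gives only closure under the shift by \<open>P\<close>;
  \<open>upward_closed_eventually_periodic\<close> makes it an equivalence, separately at each end
  of a coset.\<close>

lemma rational_eventually_periodic:
  assumes L: "regular_language A L"
  obtains P where "eventually_periodic P (ev ` L)"
proof -
  obtain P B :: int where P: "P > 0"
    "\<And>y e. \<lbrakk>y \<in> L; e \<in> {1, -1}; e * ht (ev y) \<ge> e * ht \<one> + B\<rbrakk> \<Longrightarrow> t [^] (e * P) \<otimes> ev y \<in> ev ` L"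
    using rational_pumping[OF L] by metis
  have one: "\<exists>n1. \<forall>n\<ge>n1. t [^] (e * n) \<otimes> g \<in> ev ` L \<longleftrightarrow> t [^] (e * (n + P)) \<otimes> g \<in> ev ` L"
    if g: "g \<in> carrier G" and e: "e \<in> {1, -1}" for g e
  proof (rule upward_closed_eventually_periodic[OF P(1)])
    fix n assume n: "n \<ge> \<bar>ht \<one>\<bar> + \<bar>ht g\<bar> + B" and "t [^] (e * n) \<otimes> g \<in> ev ` L"
    then obtain y where y: "y \<in> L" "ev y = t [^] (e * n) \<otimes> g"
      by auto
    then have "e * ht (ev y) = n + e * ht g"
      using g e by auto
    then have "e * ht (ev y) \<ge> e * ht \<one> + B"
      using n e by auto
    then have "t [^] (e * P) \<otimes> ev y \<in> ev ` L"
      using P(2) y(1) e by blast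
    moreover have "t [^] (e * P) \<otimes> ev y = t [^] (e * (n + P)) \<otimes> g"
      unfolding y(2) using g by (simp add: m_assoc[symmetric] int_pow_mult[symmetric] algebra_simps)
    ultimately show "t [^] (e * (n + P)) \<otimes> g \<in> ev ` L"
      by simp
  qed
  have "eventually_periodic P (ev ` L)"
    unfolding eventually_periodic_def
  proof (intro conjI ballI)
    fix g assume g: "g \<in> carrier G"
    obtain n1 n2 where
      n1: "\<forall>n\<ge>n1. t [^] (1 * n) \<otimes> g \<in> ev ` L \<longleftrightarrow> t [^] (1 * (n + P)) \<otimes> g \<in> ev ` L" and
      n2: "\<forall>n\<ge>n2. t [^] (-1 * n) \<otimes> g \<in> ev ` L \<longleftrightarrow> t [^] (-1 * (n + P)) \<otimes> g \<in> ev ` L"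
      using one[OF g, of 1] one[OF g, of "-1"] by blast
    show "\<exists>n0. \<forall>n\<ge>n0. \<forall>e\<in>{1, -1}. t [^] (e * n) \<otimes> g \<in> ev ` L \<longleftrightarrow> t [^] (e * (n + P)) \<otimes> g \<in> ev ` L"
    proof (intro exI[of _ "max n1 n2"] allI impI ballI)
      fix n e assume "max n1 n2 \<le> n" "e \<in> {1, -1::int}"
      then show "t [^] (e * n) \<otimes> g \<in> ev ` L \<longleftrightarrow> t [^] (e * (n + P)) \<otimes> g \<in> ev ` L"
        using n1[rule_format, of n] n2[rule_format, of n] by fastforce
    qed
  qed (rule P(1))
  then show ?thesis
    by (rule that)
qed

lemma conj_closure_orient1:
  assumes U: "U \<subseteq> carrier G" and g: "g \<in> carrier G" "orient g = 1"
  shows "g \<in> conj_closure G U \<longleftrightarrow> (\<exists>s\<in>R. s \<otimes> g \<otimes> inv s \<in> U)"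
proof
  assume "g \<in> conj_closure G U"
  then obtain x y where x: "x \<in> carrier G" "y \<in> U" "g = inv x \<otimes> y \<otimes> x"
    by (auto simp: conj_closure_def)
  then have y: "y \<in> carrier G" "y = x \<otimes> g \<otimes> inv x"
    using U by (auto simp: m_assoc mult_inv_cancel)
  obtain s and n :: int where s: "s \<in> R" "x = t [^] n \<otimes> s"
    using R_cover[OF x(1)] by blast
  have "y = t [^] n \<otimes> (s \<otimes> g \<otimes> inv s) \<otimes> inv (t [^] n)"
    unfolding y(2) s(2) using s(1) g by (simp add: m_assoc inv_mult_group)
  also have "\<dots> = s \<otimes> g \<otimes> inv s"
    using s(1) g by (intro t_pow_conj) auto
  finally show "\<exists>s\<in>R. s \<otimes> g \<otimes> inv s \<in> U"
    using x(2) s(1) by blast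
next
  assume "\<exists>s\<in>R. s \<otimes> g \<otimes> inv s \<in> U"
  then obtain s where s: "s \<in> R" "s \<otimes> g \<otimes> inv s \<in> U"
    by blast
  have "g = inv s \<otimes> (s \<otimes> g \<otimes> inv s) \<otimes> s"
    using s(1) g by (simp add: m_assoc mult_inv_cancel)
  then show "g \<in> conj_closure G U"
    unfolding conj_closure_def using s R_closed by blast
qed

text \<open>Conjugation by \<open>s\<close> turns the exponent \<open>e * n\<close> into
  \<open>orient s * e * n\<close>: an inverting \<open>s\<close> swaps the two ends of a coset,
  which is why both signs are handled together. Finiteness of \<open>R\<close> gives a common
  threshold.\<close>

lemma eventually_periodic_conj_closure:
  assumes U: "U \<subseteq> carrier G" and per: "eventually_periodic P U"
  shows "eventually_periodic P {g \<in> carrier G. orient g = 1 \<and> g \<in> conj_closure G U}" (is "eventually_periodic P ?V")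
  unfolding eventually_periodic_def
proof (intro conjI ballI)
  show "P > 0"
    using per by (simp add: eventually_periodic_def)
  fix g assume g: "g \<in> carrier G"
  have "\<exists>n0::int. \<forall>n\<ge>n0. \<forall>e\<in>{1, -1}. t [^] (e * n) \<otimes> (s \<otimes> g \<otimes> inv s) \<in> U \<longleftrightarrow>
      t [^] (e * (n + P)) \<otimes> (s \<otimes> g \<otimes> inv s) \<in> U" if "s \<in> R" for s
    using per that g unfolding eventually_periodic_def by simp
  then obtain N :: "'a \<Rightarrow> int" where N: "\<And>s n e. \<lbrakk>s \<in> R; n \<ge> N s; e \<in> {1, -1}\<rbrakk> \<Longrightarrow>
      t [^] (e * n) \<otimes> (s \<otimes> g \<otimes> inv s) \<in> U \<longleftrightarrow> t [^] (e * (n + P)) \<otimes> (s \<otimes> g \<otimes> inv s) \<in> U"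
    by metis
  have mem: "t [^] (e * n) \<otimes> g \<in> ?V \<longleftrightarrow>
      orient g = 1 \<and> (\<exists>s\<in>R. t [^] ((orient s * e) * n) \<otimes> (s \<otimes> g \<otimes> inv s) \<in> U)" for e n :: int
  proof -
    have "s \<otimes> (t [^] (e * n) \<otimes> g) \<otimes> inv s = t [^] ((orient s * e) * n) \<otimes> (s \<otimes> g \<otimes> inv s)" if "s \<in> R" for s
    proof -
      have "s \<otimes> (t [^] (e * n) \<otimes> g) \<otimes> inv s = (s \<otimes> t [^] (e * n)) \<otimes> (g \<otimes> inv s)"
        using that g by (simp add: m_assoc)
      also have "\<dots> = (t [^] (orient s * (e * n)) \<otimes> s) \<otimes> (g \<otimes> inv s)"
        using comm_t_pow[of s "e * n"] that by simp
      finally show ?thesis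
        using that g by (simp add: m_assoc mult.assoc)
    qed
    then show ?thesis
      using conj_closure_orient1[OF U, of "t [^] (e * n) \<otimes> g"] g by auto
  qed
  show "\<exists>n0::int. \<forall>n\<ge>n0. \<forall>e\<in>{1, -1}. t [^] (e * n) \<otimes> g \<in> ?V \<longleftrightarrow> t [^] (e * (n + P)) \<otimes> g \<in> ?V"
  proof (intro exI[of _ "Max (N ` R)"] allI impI ballI)
    fix n e :: int assume n: "n \<ge> Max (N ` R)" and e: "e \<in> {1, -1}"
    have "t [^] ((orient s * e) * n) \<otimes> (s \<otimes> g \<otimes> inv s) \<in> U \<longleftrightarrow>
        t [^] ((orient s * e) * (n + P)) \<otimes> (s \<otimes> g \<otimes> inv s) \<in> U" if s: "s \<in> R" for s
    proof (rule N[OF s])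
      show "n \<ge> N s"
        using n Max_ge[OF finite_imageI[OF finite_R], of "N s" N] s by (meson imageI order_trans)
      show "orient s * e \<in> {1, -1}"
        using e orient_cases[of s] by auto
    qed
    then show "t [^] (e * n) \<otimes> g \<in> ?V \<longleftrightarrow> t [^] (e * (n + P)) \<otimes> g \<in> ?V"
      unfolding mem by blast
  qed
qed

section \<open>Periodic sets read off from geodesic words\<close>

lemma finite_ht_bounded: "finite {g \<in> carrier G. \<bar>ht g\<bar> \<le> N}"
proof (rule finite_subset)
  show "{g \<in> carrier G. \<bar>ht g\<bar> \<le> N} \<subseteq> (\<lambda>(n, s). t [^] n \<otimes> s) ` ({-N..N} \<times> R)"
  proof
    fix g assume "g \<in> {g \<in> carrier G. \<bar>ht g\<bar> \<le> N}"
    then show "g \<in> (\<lambda>(n, s). t [^] n \<otimes> s) ` ({-N..N} \<times> R)"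
      using ht_rep[of g] rep_R[of g] by (intro image_eqI[of _ _ "(ht g, rep g)"]) auto
  qed
  show "finite ((\<lambda>(n, s). t [^] n \<otimes> s) ` ({-N..N} \<times> R))"
    using finite_R by blast
qed

text \<open>A geodesic changing sides after time \<open>i\<close> would be within \<open>D\<close>
  of \<open>\<one>\<close> at some time \<open>j \<ge> i\<close>, but its distance from
  \<open>\<one>\<close> is then \<open>j > D\<close>.\<close>

lemma geodesic_ht_side:
  obtains D where "\<And>w i. \<lbrakk>geodesic w; D < i; i \<le> length w\<rbrakk> \<Longrightarrow>
     ht (ev (take i w)) \<le> ht \<one> \<longleftrightarrow> ht (ev w) \<le> ht \<one>"
proof -
  obtain D where D: "\<And>w c i k. \<lbrakk>w \<in> lists A; c \<in> carrier G; i \<le> k;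
     ht (ev (take i w)) \<le> ht c \<and> ht c \<le> ht (ev (take k w)) \<or>
     ht (ev (take k w)) \<le> ht c \<and> ht c \<le> ht (ev (take i w))\<rbrakk> \<Longrightarrow>
     \<exists>j. i \<le> j \<and> j \<le> k \<and> gdist (ev (take j w)) c \<le> D"
    using crossing by blast
  show ?thesis
  proof (rule that[of D], rule ccontr)
    fix w i
    assume w: "geodesic w" and i: "D < i" "i \<le> length w"
      and ne: "(ht (ev (take i w)) \<le> ht \<one>) \<noteq> (ht (ev w) \<le> ht \<one>)"
    have "ht (ev (take i w)) \<le> ht \<one> \<and> ht \<one> \<le> ht (ev (take (length w) w)) \<or>
        ht (ev (take (length w) w)) \<le> ht \<one> \<and> ht \<one> \<le> ht (ev (take i w))"
      using ne by auto
    then obtain j where j: "i \<le> j" "j \<le> length w" "gdist (ev (take j w)) \<one> \<le> D"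
      using D[OF geodesic_lists[OF w] one_closed i(2)] by blast
    have "gdist (ev (take j w)) \<one> = j"
      using gdist_sym[of "ev (take j w)" \<one>] geodesic_wlen_take[OF w j(2)] geodesic_lists[OF w]
      by (simp add: gdist_one)
    then show False
      using i(1) j(1,3) by simp
  qed
qed

text \<open>The state holds the first \<open>b\<close> letters, the coset, the height modulo
  \<open>P\<close> and a state for shortlex-least words. The last makes the words geodesic, which is
  what lets a prefix tell the side of the element.\<close>

lemma regular_shortlex_least_periodic:
  assumes r: "linear_order_on A r" and per: "eventually_periodic P V"
  shows "regular_language A {w. shortlex_least r {ev w} w \<and> ev w \<in> V}"
proof -
  let ?SL = "{w. shortlex_least r {ev w} w}"
  have P: "P > 0"
    using per by (simp add: eventually_periodic_def)
  obtain N :: "'a \<Rightarrow> int" where N: "\<And>s n e. \<lbrakk>s \<in> R; n \<ge> N s; e \<in> {1, -1}\<rbrakk> \<Longrightarrow>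
      t [^] (e * n) \<otimes> s \<in> V \<longleftrightarrow> t [^] (e * (n + P)) \<otimes> s \<in> V"
    using per R_carrier unfolding eventually_periodic_def by (metis subsetD)
  have N_mult: "t [^] (e * n) \<otimes> s \<in> V \<longleftrightarrow> t [^] (e * (n + int k * P)) \<otimes> s \<in> V"
    if s: "s \<in> R" and n: "n \<ge> N s" and e: "e \<in> {1, -1}" for s n e k
  proof (induction k)
    case (Suc k)
    have "n + int k * P \<ge> N s"
      using n P by (simp add: add_increasing2)
    moreover have "n + int (Suc k) * P = n + int k * P + P"
      by (simp add: algebra_simps)
    ultimately show ?case
      using Suc N[OF s _ e, of "n + int k * P"] by (simp only:)
  qed simp
  have N_le: "t [^] (e * n) \<otimes> s \<in> V \<longleftrightarrow> t [^] (e * n') \<otimes> s \<in> V"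
    if s: "s \<in> R" and e: "e \<in> {1, -1}" and n: "n \<ge> N s" "n \<le> n'" "n mod P = n' mod P" for s n n' e
  proof -
    obtain q where q: "n' - n = P * q"
      using n(3) by (metis dvdE mod_eq_dvd_iff)
    then have "q \<ge> 0"
      using n(2) P by (metis diff_ge_0_iff_ge linorder_not_less mult_pos_neg)
    then have "n' = n + int (nat q) * P"
      using q by (simp add: algebra_simps)
    then show ?thesis
      using N_mult[OF s n(1) e, of "nat q"] by simp
  qed
  have N_cong: "t [^] (e * n) \<otimes> s \<in> V \<longleftrightarrow> t [^] (e * n') \<otimes> s \<in> V"
    if "s \<in> R" "e \<in> {1, -1}" "n \<ge> N s" "n' \<ge> N s" "n mod P = n' mod P" for s n n' e
    using N_le[OF that(1,2,3) _ that(5)] N_le[OF that(1,2,4) _ that(5)[symmetric]] by (meson nle_le)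
  \<comment> \<open>\<open>M\<close> dominates all thresholds, and also
    \<open>\<bar>ht \<one>\<bar>\<close>, so that a height of absolute value above \<open>M\<close>
    is positive or negative according to its comparison with \<open>ht \<one>\<close>.\<close>
  define M where "M = Max (insert \<bar>ht \<one>\<bar> (N ` R))"
  have fin: "finite (insert \<bar>ht \<one>\<bar> (N ` R))"
    using finite_R by blast
  have M: "\<bar>ht \<one>\<bar> \<le> M" "s \<in> R \<Longrightarrow> N s \<le> M" for s
    unfolding M_def by (rule Max_ge[OF fin], simp)+
  obtain D where D: "\<And>w i. \<lbrakk>geodesic w; D < i; i \<le> length w\<rbrakk> \<Longrightarrow>
     ht (ev (take i w)) \<le> ht \<one> \<longleftrightarrow> ht (ev w) \<le> ht \<one>"
    using geodesic_ht_side by blast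
  \<comment> \<open>\<open>b\<close> exceeds \<open>D\<close>, so a prefix of length
    \<open>b\<close> fixes the side, and exceeds the word length of every element with height in
    \<open>{-M..M}\<close>, so longer geodesics are past all thresholds.\<close>
  define b where "b = Suc (max D (Max (insert 0 (wlen ` {g \<in> carrier G. \<bar>ht g\<bar> \<le> M}))))"
  have "D < b"
    by (simp add: b_def)
  have b: "\<bar>ht g\<bar> > M" if g: "g \<in> carrier G" "wlen g \<ge> b" for g
  proof (rule ccontr)
    assume "\<not> \<bar>ht g\<bar> > M"
    then have "wlen g \<le> Max (insert 0 (wlen ` {g \<in> carrier G. \<bar>ht g\<bar> \<le> M}))"
      using g finite_ht_bounded by (intro Max_ge) auto
    then show False
      using g(2) by (simp add: b_def)
  qed
  obtain \<phi> :: "'a list \<Rightarrow> nat" where \<phi>: "finite (\<phi> ` lists A)"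
    "\<And>u v a. \<lbrakk>u \<in> lists A; v \<in> lists A; a \<in> A; \<phi> u = \<phi> v\<rbrakk> \<Longrightarrow> \<phi> (u @ [a]) = \<phi> (v @ [a])"
    "\<And>u v. \<lbrakk>u \<in> lists A; v \<in> lists A; \<phi> u = \<phi> v\<rbrakk> \<Longrightarrow> u \<in> ?SL \<longleftrightarrow> v \<in> ?SL"
    by (rule regular_languageE[OF regular_shortlex_least[OF r]]) (rule that)
  define \<psi> where "\<psi> w = (\<phi> w, take b w, rep (ev w), ht (ev w) mod P)" for w
  show ?thesis
  proof (rule regular_languageI[of A _ \<psi>])
    show "{w. shortlex_least r {ev w} w \<and> ev w \<in> V} \<subseteq> lists A"
      by (auto simp: shortlex_least_def)
    show "finite (\<psi> ` lists A)"
    proof (rule finite_subset)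
      show "\<psi> ` lists A \<subseteq> \<phi> ` lists A \<times> take b ` lists A \<times> R \<times> {0..<P}"
        using P rep_R by (force simp: \<psi>_def)
      show "finite (\<phi> ` lists A \<times> take b ` lists A \<times> R \<times> {0..<P})"
        using \<phi>(1) finite_take_image[OF finite_A] finite_R by blast
    qed
  next
    fix u v a assume u: "u \<in> lists A" and v: "v \<in> lists A" and a: "a \<in> A" and eq: "\<psi> u = \<psi> v"
    have "\<phi> (u @ [a]) = \<phi> (v @ [a])"
      using \<phi>(2)[OF u v a] eq by (simp add: \<psi>_def)
    moreover have "take b (u @ [a]) = take b (v @ [a])"
      using eq by (intro take_snoc_cong) (simp add: \<psi>_def)
    moreover have "rep (ev (u @ [a])) = rep (ev (v @ [a]))"
      using ht_rep_mult(2)[of "ev u" a] ht_rep_mult(2)[of "ev v" a] eq u v a by (simp add: \<psi>_def)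
    moreover have "ht (ev (u @ [a])) mod P = ht (ev (v @ [a])) mod P"
      using ht_rep_mult(1)[of "ev u" a] ht_rep_mult(1)[of "ev v" a] eq u v a
        mod_add_cong[of "ht (ev u)" P "ht (ev v)" "ht (rep (ev u) \<otimes> a)" "ht (rep (ev u) \<otimes> a)"]
      by (simp add: \<psi>_def)
    ultimately show "\<psi> (u @ [a]) = \<psi> (v @ [a])"
      by (simp add: \<psi>_def)
  next
    fix u v assume u: "u \<in> lists A" and v: "v \<in> lists A" and eq: "\<psi> u = \<psi> v"
      and "u \<in> {w. shortlex_least r {ev w} w \<and> ev w \<in> V}"
    then have SLu: "u \<in> ?SL" and uV: "ev u \<in> V"
      by auto
    then have SLv: "v \<in> ?SL"
      using \<phi>(3)[OF u v] eq by (simp add: \<psi>_def)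
    have gu: "geodesic u" and gv: "geodesic v"
      using SLu SLv shortlex_least_geodesic by auto
    have pre: "take b u = take b v" and rep: "rep (ev u) = rep (ev v)"
      and md: "ht (ev u) mod P = ht (ev v) mod P"
      using eq by (auto simp: \<psi>_def)
    have "ev v \<in> V"
    \<comment> \<open>A word shorter than \<open>b\<close> is stored whole in the state.\<close>
    proof (cases "length u < b \<or> length v < b")
      case True
      then have "u = v"
        using eq_of_take_eq[OF pre] eq_of_take_eq[OF pre[symmetric]] by blast
      then show ?thesis
        using uV by simp
    next
      case False
      then have lu: "b \<le> length u" and lv: "b \<le> length v"
        by auto
      define e :: int where "e = (if ht (ev u) \<le> ht \<one> then -1 else 1)"
      have e: "e \<in> {1, -1}"
        by (simp add: e_def)
      have side: "ht (ev u) \<le> ht \<one> \<longleftrightarrow> ht (ev v) \<le> ht \<one>"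
        using D[OF gu \<open>D < b\<close> lu] D[OF gv \<open>D < b\<close> lv] pre by simp
      have "\<bar>ht (ev u)\<bar> > M" "\<bar>ht (ev v)\<bar> > M"
        using b[of "ev u"] b[of "ev v"] gu gv u v lu lv by (auto simp: geodesic_def)
      then have big: "e * ht (ev u) > M" "e * ht (ev v) > M"
        using side M(1) by (auto simp: e_def)
      have "(e * ht (ev u)) mod P = (e * ht (ev v)) mod P"
        using md by (metis mod_mult_right_eq)
      then have "t [^] (e * (e * ht (ev u))) \<otimes> rep (ev u) \<in> V \<longleftrightarrow>
          t [^] (e * (e * ht (ev v))) \<otimes> rep (ev u) \<in> V"
        using N_cong[OF rep_R e, of "ev u" "e * ht (ev u)" "e * ht (ev v)"] u big M(2)[of "rep (ev u)"]
          rep_R[of "ev u"] by fastforce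
      moreover have "e * (e * n) = n" for n
        using e by auto
      ultimately show ?thesis
        using uV ht_rep[of "ev u"] ht_rep[of "ev v"] rep u v by simp
    qed
    then show "v \<in> {w. shortlex_least r {ev w} w \<and> ev w \<in> V}"
      using SLv by simp
  qed (rule finite_A)
qed

lemma regular_ConjSL:
  assumes A: "A = sym_gens G X" and r: "linear_order_on A r" and U: "rational_subset G X U"
  shows "regular_language A (ConjSL G X r U)"
proof -
  obtain L where L: "regular_language A L" "U = ev ` L"
    using U by (auto simp: rational_subset_def A)
  have UG: "U \<subseteq> carrier G"
    using L by (auto simp: regular_language_def)
  obtain P where "eventually_periodic P U"
    using rational_eventually_periodic[OF L(1)] L(2) by blast
  then have "eventually_periodic P {g \<in> carrier G. orient g = 1 \<and> g \<in> conj_closure G U}"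
    by (rule eventually_periodic_conj_closure[OF UG])
  then have reg1: "regular_language A {w. shortlex_least r {ev w} w \<and>
      ev w \<in> {g \<in> carrier G. orient g = 1 \<and> g \<in> conj_closure G U}}" (is "regular_language A ?M")
    by (rule regular_shortlex_least_periodic[OF r])
  obtain K where K: "regular_language A K"
    "\<And>w. \<lbrakk>w \<in> lists A; orient (ev w) = 1\<rbrakk> \<Longrightarrow> w \<in> K \<longleftrightarrow> shortlex_least r (conj_class (ev w)) w"
    using regular_conj_least[OF r] by blast
  define L1 where "L1 = {w \<in> ConjSL G X r U. orient (ev w) \<noteq> 1}"
  have "L1 \<subseteq> conj_rep G X r ` {conj_class g | g. g \<in> carrier G \<and> orient g \<noteq> 1}"
  proof
    fix w assume "w \<in> L1"
    then have w: "orient (ev w) \<noteq> 1" "shortlex_least r (conj_class (ev w)) w"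
      by (auto simp: L1_def ConjSL_eq[OF A r])
    then have "ev w \<in> carrier G"
      by (simp add: shortlex_least_def)
    then show "w \<in> conj_rep G X r ` {conj_class g | g. g \<in> carrier G \<and> orient g \<noteq> 1}"
      using conj_rep_eqI[OF A r w(2)] w(1) by force
  qed
  then have "finite L1"
    using finite_subset finite_conj_classes_reversing by blast
  moreover have "L1 \<subseteq> lists A"
    using ConjSL_lists[OF A r] by (auto simp: L1_def)
  ultimately have "regular_language A L1"
    using regular_language_finite[OF finite_A] by blast
  \<comment> \<open>\<open>K\<close> is meaningful at orientation 1, which \<open>?M\<close>
    enforces; the other words form the finite set \<open>L1\<close>, for which membership in the
    conjugates of \<open>U\<close> needs no test.\<close>
  moreover have "ConjSL G X r U = L1 \<union> (K \<inter> ?M)"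
  proof (intro equalityI subsetI)
    fix w assume w: "w \<in> ConjSL G X r U"
    then have l: "ev w \<in> conj_closure G U" "shortlex_least r (conj_class (ev w)) w" "w \<in> lists A"
      by (auto simp: ConjSL_eq[OF A r] shortlex_least_def)
    then have "shortlex_least r {ev w} w"
      using shortlex_least_mono[OF l(2), of "{ev w}"] conj_class_refl[of "ev w"] by simp
    then show "w \<in> L1 \<union> (K \<inter> ?M)"
      using w l K(2)[OF l(3)] by (auto simp: L1_def)
  next
    fix w assume "w \<in> L1 \<union> (K \<inter> ?M)"
    then consider "w \<in> L1" | "w \<in> K" "w \<in> ?M"
      by blast
    then show "w \<in> ConjSL G X r U"
    proof cases
      case 2
      then have "w \<in> lists A" "orient (ev w) = 1" "ev w \<in> conj_closure G U"
        by (auto simp: shortlex_least_def)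
      then show ?thesis
        using K(2)[of w] 2(1) by (simp add: ConjSL_eq[OF A r])
    qed (simp add: L1_def)
  qed
  ultimately show ?thesis
    using K(1) reg1 by (simp only: regular_language_union regular_language_inter)
qed

end

section \<open>Virtually cyclic groups\<close>

context group
begin

text \<open>Pigeonhole on the cosets \<open>H #> (g \<otimes> x [^] i)\<close>: two agree for
  \<open>i\<close> up to the index, and \<open>k\<close> is the difference of the exponents. The
  bound on \<open>k\<close> is independent of \<open>g\<close>, which lets one factorial serve every
  conjugator.\<close>

lemma conj_pow_in_finite_index_subgroup:
  assumes H: "subgroup H G" and fin: "finite (rcosets H)" and g: "g \<in> carrier G" and x: "x \<in> carrier G"
  obtains k :: nat where "0 < k" "k \<le> card (rcosets H)" "g \<otimes> x [^] k \<otimes> inv g \<in> H"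
proof -
  let ?d = "card (rcosets H)"
  define f where "f i = H #> (g \<otimes> x [^] i)" for i :: nat
  have HG: "H \<subseteq> carrier G"
    using H by (rule subgroup.subset)
  have "f ` {..?d} \<subseteq> rcosets H"
    using g x HG by (auto simp: f_def intro!: rcosetsI)
  then have "card (f ` {..?d}) < card {..?d}"
    using card_mono[OF fin] by (simp add: less_Suc_eq_le)
  then have "\<not> inj_on f {..?d}"
    by (rule pigeonhole)
  then obtain i j where ij: "i < j" "j \<le> ?d" "f i = f j"
    unfolding inj_on_def by (metis atMost_iff linorder_neqE_nat)
  have "g \<otimes> x [^] j \<in> H #> (g \<otimes> x [^] i)"
    using ij(3) rcos_self[OF _ H, of "g \<otimes> x [^] j"] g x by (simp add: f_def)
  then obtain h where h: "h \<in> H" "g \<otimes> x [^] j = h \<otimes> (g \<otimes> x [^] i)"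
    by (auto simp: r_coset_def)
  have hG: "h \<in> carrier G"
    using h(1) HG by blast
  have "g \<otimes> x [^] (j - i) \<otimes> x [^] i = g \<otimes> x [^] j"
    using ij(1) g x by (simp add: m_assoc nat_pow_mult)
  also have "\<dots> = h \<otimes> g \<otimes> x [^] i"
    unfolding h(2) using hG g x by (simp add: m_assoc)
  finally have "g \<otimes> x [^] (j - i) = h \<otimes> g"
    using g x hG by simp
  then have "g \<otimes> x [^] (j - i) \<otimes> inv g = h"
    using g hG by (simp add: m_assoc)
  then show ?thesis
    using that[of "j - i"] ij h(1) by auto
qed

lemma int_pow_inj_of_infinite_range:
  assumes a: "a \<in> carrier G" and inf: "infinite (range (\<lambda>n::int. a [^] n))"
    and eq: "a [^] (m::int) = a [^] (n::int)"
  shows "m = n"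
proof (rule ccontr)
  assume "m \<noteq> n"
  define k where "k = \<bar>m - n\<bar>"
  have "k > 0"
    using \<open>m \<noteq> n\<close> by (simp add: k_def)
  have "a [^] (m - n) = \<one>" "a [^] (n - m) = \<one>"
    using a eq by (simp_all add: int_pow_diff)
  then have k1: "a [^] k = \<one>"
    by (auto simp: k_def abs_if)
  have "a [^] i = a [^] (i mod k)" for i
  proof -
    have "a [^] i = a [^] (k * (i div k) + i mod k)"
      by simp
    also have "\<dots> = (a [^] k) [^] (i div k) \<otimes> a [^] (i mod k)"
      using a by (simp only: int_pow_mult int_pow_pow)
    finally show ?thesis
      using a k1 by simp
  qed
  moreover have "i mod k \<in> {0..<k}" for i
    using \<open>k > 0\<close> by simp
  ultimately have "range (\<lambda>n::int. a [^] n) \<subseteq> (\<lambda>n. a [^] n) ` {0..<k}"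
    by (metis (no_types, lifting) image_eqI image_subsetI)
  then show False
    using inf finite_subset by blast
qed

text \<open>If \<open>g\<close> conjugates \<open>a ^ M\<close> to \<open>a ^ k\<close> then \<open>g ^ i\<close> conjugates \<open>a ^ M ^ i\<close> to \<open>a ^ k ^ i\<close>.
  As some positive power of \<open>g\<close> lies in the cyclic subgroup, \<open>\<bar>k\<bar> = M\<close>.\<close>

lemma virtually_infinite_cyclicE:
  assumes H: "subgroup H G" and cyc: "cyclic_group (G\<lparr>carrier := H\<rparr>)" and fin: "finite (rcosets H)"
    and inf: "infinite (carrier G)"
  obtains t R where "t \<in> carrier G" "\<And>m n :: int. t [^] m = t [^] n \<Longrightarrow> m = n"
    "\<And>g. g \<in> carrier G \<Longrightarrow> g \<otimes> t \<otimes> inv g \<in> {t, inv t}"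
    "finite R" "R \<subseteq> carrier G" "\<And>g. g \<in> carrier G \<Longrightarrow> \<exists>s\<in>R. \<exists>n::int. g = t [^] n \<otimes> s"
proof -
  have HG: "H \<subseteq> carrier G"
    using H by (rule subgroup.subset)
  obtain a where a: "a \<in> H" and "H = range (\<lambda>n::int. a [^]\<^bsub>G\<lparr>carrier := H\<rparr>\<^esub> n)"
    using cyc group.cyclic_group[OF subgroup.subgroup_is_group[OF H is_group]] by auto
  then have H_eq: "H = range (\<lambda>n::int. a [^] n)"
    using int_pow_consistent[OF H a] by simp
  have aG: "a \<in> carrier G"
    using a HG by blast
  have "infinite H"
  proof
    assume "finite H"
    then have "finite (\<Union> (rcosets H))"
      using fin rcosets_finite[OF _ HG] by blast
    then show False
      using inf rcosets_part_G[OF H] by simp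
  qed
  then have a_inj: "m = n" if "a [^] m = a [^] n" for m n :: int
    using int_pow_inj_of_infinite_range[OF aG] that H_eq by simp
  \<comment> \<open>For every \<open>g\<close> some positive \<open>k\<close> up to the index puts
    \<open>g \<otimes> a [^] k \<otimes> inv g\<close> into \<open>H\<close>; as \<open>M\<close> is
    a multiple of each such \<open>k\<close>, all conjugates of \<open>a [^] M\<close> lie in
    \<open>H\<close>.\<close>
  define M :: int where "M = fact (card (rcosets H))"
  have M: "M > 0"
    by (simp add: M_def)
  define t where "t = a [^] M"
  have tG: "t \<in> carrier G"
    using aG by (simp add: t_def)
  have t_pow: "t [^] n = a [^] (M * n)" for n :: int
    using aG by (simp add: t_def int_pow_pow)
  have conj: "g \<otimes> t \<otimes> inv g \<in> {t, inv t}" if g: "g \<in> carrier G" for g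
  proof -
    obtain k :: nat where k: "0 < k" "k \<le> card (rcosets H)" "g \<otimes> a [^] k \<otimes> inv g \<in> H"
      using conj_pow_in_finite_index_subgroup[OF H fin g aG] by blast
    have "k dvd fact (card (rcosets H))"
      using k(1,2) by (intro dvd_fact) auto
    then obtain q where "fact (card (rcosets H)) = k * q"
      by (auto simp: dvd_def)
    then have q: "M = int k * int q"
      unfolding M_def by (metis of_nat_fact of_nat_mult)
    have "t = (a [^] int k) [^] int q"
      using aG by (simp add: t_def q int_pow_pow)
    then have "g \<otimes> t \<otimes> inv g = (g \<otimes> a [^] k \<otimes> inv g) [^] int q"
      using conj_int_pow[OF g, of "a [^] int k" "int q"] aG by (simp add: int_pow_int)
    then have "g \<otimes> t \<otimes> inv g \<in> H"
      using subgroup_int_pow_closed[OF H k(3)] by simp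
    then obtain c :: int where c: "g \<otimes> t \<otimes> inv g = a [^] c"
      using H_eq by auto
    have iter: "g [^] i \<otimes> a [^] (M ^ i) \<otimes> inv (g [^] i) = a [^] (c ^ i)" for i :: nat
    proof (induction i)
      case (Suc i)
      have gi: "g [^] Suc i = g \<otimes> g [^] i"
        by (rule nat_pow_Suc2[OF g])
      have "g [^] Suc i \<otimes> a [^] (M ^ Suc i) \<otimes> inv (g [^] Suc i) =
          g \<otimes> (g [^] i \<otimes> a [^] (M ^ Suc i) \<otimes> inv (g [^] i)) \<otimes> inv g"
        unfolding gi using g aG by (simp add: m_assoc inv_mult_group)
      also have "g [^] i \<otimes> a [^] (M ^ Suc i) \<otimes> inv (g [^] i) = (a [^] (c ^ i)) [^] M"
        using conj_int_pow[of "g [^] i" "a [^] (M ^ i)" M] Suc g aG by (simp add: int_pow_pow mult.commute)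
      also have "(a [^] (c ^ i)) [^] M = t [^] (c ^ i)"
        using aG by (simp add: t_def int_pow_pow mult.commute)
      also have "g \<otimes> t [^] (c ^ i) \<otimes> inv g = a [^] (c ^ Suc i)"
        using conj_int_pow[OF g tG, of "c ^ i"] aG by (simp add: c int_pow_pow)
      finally show ?case .
    qed (use aG in simp)
    obtain l :: nat where l: "0 < l" "\<one> \<otimes> g [^] l \<otimes> inv \<one> \<in> H"
      using conj_pow_in_finite_index_subgroup[OF H fin one_closed g] by blast
    then obtain d :: int where d: "g [^] l = a [^] d"
      using H_eq g by auto
    \<comment> \<open>\<open>g [^] l\<close> is a power of \<open>a\<close> and so commutes with
      \<open>a\<close>; comparison with \<open>iter\<close> gives
      \<open>M ^ l = c ^ l\<close>.\<close>
    have "a [^] d \<otimes> a [^] (M ^ l) = a [^] (M ^ l) \<otimes> a [^] d"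
      using aG by (simp add: int_pow_mult[symmetric] add.commute)
    then have "a [^] d \<otimes> a [^] (M ^ l) \<otimes> inv (a [^] d) = a [^] (M ^ l)"
      using aG by (simp add: m_assoc)
    then have "M ^ l = c ^ l"
      using iter[of l] a_inj unfolding d by simp
    then have "M ^ l = \<bar>c\<bar> ^ l"
      using M by (metis abs_of_pos power_abs zero_less_power)
    then have "\<bar>c\<bar> = M"
      using power_eq_imp_eq_base[of "\<bar>c\<bar>" l M] l(1) M by simp
    then have "c = M \<or> c = -M"
      by linarith
    then show ?thesis
      using c aG by (auto simp: t_def int_pow_neg)
  qed
  define f where "f C = (SOME y. y \<in> C)" for C :: "'a set"
  have f: "f C \<in> C" if "C \<in> rcosets H" for C
    unfolding f_def using subgroup.rcosets_non_empty[OF H that] by (simp add: some_in_eq)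
  have fG: "f C \<in> carrier G" if "C \<in> rcosets H" for C
    using f[OF that] rcosets_part_G[OF H] that by blast
  \<comment> \<open>The powers of \<open>a\<close> account for the cosets of
    \<open>\<langle>t\<rangle>\<close> in \<open>H\<close>, the elements \<open>f C\<close> for
    those of \<open>H\<close> in the group.\<close>
  define R where "R = (\<lambda>(j, C). a [^] j \<otimes> f C) ` ({0..<M} \<times> (rcosets H))"
  have "\<exists>s\<in>R. \<exists>n::int. g = t [^] n \<otimes> s" if g: "g \<in> carrier G" for g
  proof -
    let ?C = "H #> g"
    have C: "?C \<in> rcosets H"
      using rcosetsI[OF HG g] .
    obtain h where h: "h \<in> H" "f ?C = h \<otimes> g"
      using f[OF C] by (auto simp: r_coset_def)
    have "inv h \<in> H"
      using subgroup.m_inv_closed[OF H h(1)] .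
    then obtain n :: int where n: "inv h = a [^] n"
      using H_eq by auto
    have "g = inv h \<otimes> f ?C"
      unfolding h(2) using h(1) HG g by (auto simp: mult_inv_cancel)
    also have "\<dots> = a [^] (M * (n div M) + n mod M) \<otimes> f ?C"
      by (simp add: n)
    also have "\<dots> = t [^] (n div M) \<otimes> (a [^] (n mod M) \<otimes> f ?C)"
      by (simp only: int_pow_mult[OF aG] t_pow m_assoc int_pow_closed[OF aG] fG[OF C])
    finally have "g = t [^] (n div M) \<otimes> (a [^] (n mod M) \<otimes> f ?C)" .
    moreover have "a [^] (n mod M) \<otimes> f ?C \<in> R"
      unfolding R_def using C M by (intro image_eqI[of _ _ "(n mod M, ?C)"]) auto
    ultimately show ?thesis
      by blast
  qed
  moreover have "finite R" "R \<subseteq> carrier G"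
    using fin fG aG by (auto simp: R_def)
  moreover have "m = n" if "t [^] m = t [^] n" for m n :: int
    using that a_inj[of "M * m" "M * n"] M by (simp add: t_pow)
  ultimately show ?thesis
    using that[of t R] tG conj by blast
qed

end

lemma (in group) word_group_sym_gens:
  assumes "finite X" "X \<subseteq> carrier G" "generate G X = carrier G"
  shows "word_group G (sym_gens G X)"
proof unfold_locales
  show "inv x \<in> sym_gens G X" if "x \<in> sym_gens G X" for x
    using that assms(2) by (auto simp: sym_gens_def)
  show "\<exists>w\<in>lists (sym_gens G X). word_eval G w = g" if "g \<in> carrier G" for g
    using word_eval_surj[OF assms(2)] that assms(3) by simp
qed (use assms in \<open>auto simp: sym_gens_def\<close>)

theorem theorem6p1:
  fixes G :: "('a, 'b) monoid_scheme"
    and X U :: "'a set"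
    and r :: "('a \<times> 'a) set"
  assumes "group G"
    and "virtually_cyclic G"
    and "finite X"
    and "X \<subseteq> carrier G"
    and "generate G X = carrier G"
    and "linear_order_on (sym_gens G X) r"
    and "rational_subset G X U"
  shows "regular_language (sym_gens G X) (ConjSL G X r U)"
proof -
  interpret group G by fact
  let ?A = "sym_gens G X"
  interpret word_group G ?A
    using word_group_sym_gens assms(3-5) by blast
  show ?thesis
  proof (cases "finite (carrier G)")
    \<comment> \<open>A finite group has finitely many classes, hence a finite language of
      representatives.\<close>
    case True
    then have "finite (conj_classes G)"
      by (simp add: conj_classes_eq)
    moreover have "ConjSL G X r U \<subseteq> conj_rep G X r ` conj_classes G"
      by (auto simp: ConjSL_def)
    ultimately have "finite (ConjSL G X r U)"
      using finite_subset by blast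
    then show ?thesis
      using regular_language_finite[OF finite_A] ConjSL_lists[OF refl assms(6)] by blast
  next
    case False
    obtain H where H: "subgroup H G" "cyclic_group (G\<lparr>carrier := H\<rparr>)" "finite (rcosets\<^bsub>G\<^esub> H)"
      using assms(2) by (auto simp: virtually_cyclic_def)
    obtain t R where "t \<in> carrier G" "\<And>m n :: int. t [^]\<^bsub>G\<^esub> m = t [^]\<^bsub>G\<^esub> n \<Longrightarrow> m = n"
      "\<And>g. g \<in> carrier G \<Longrightarrow> g \<otimes>\<^bsub>G\<^esub> t \<otimes>\<^bsub>G\<^esub> inv\<^bsub>G\<^esub> g \<in> {t, inv\<^bsub>G\<^esub> t}"
      "finite R" "R \<subseteq> carrier G" "\<And>g. g \<in> carrier G \<Longrightarrow> \<exists>s\<in>R. \<exists>n::int. g = t [^]\<^bsub>G\<^esub> n \<otimes>\<^bsub>G\<^esub> s"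
      using virtually_infinite_cyclicE[OF H False] by metis
    then interpret virtually_Z G ?A t R
      by unfold_locales
    show ?thesis
      by (rule regular_ConjSL[OF refl assms(6,7)])
  qed
qed

end
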